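(* There exists a constant $C>0$ such that: (i) for every $H\ge -C$, the family $\{\Sigma^+_{H,c}\}_{-8M^3H\ge c>c_H}$ forms a foliation in region II, i.e. the intersections of the members of this family with region II are pairwise disjoint and their union is $\{(U,V): U<0,\ V>0,\ r_H<r(U,V)<2M\}$; (ii) for every $H\le C$, the family $\{\tilde\Sigma^-_{H,c}\}_{C_H>c>-8M^3H}$ forms a foliation in region II$'$, i.e. the intersections of the members of this family with region II$'$ are pairwise disjoint and their union is $\{(U,V): U>0,\ V<0,\ R_H<r(U,V)<2M\}$.
   Context: Fix $M>0$ and put $h(r)=1-\frac{2M}{r}$. The Kruskal extension of the Schwarzschild spacetime is $\{(U,V)\in\mathbb{R}^2: UV>-2M\}\times S^2$ with metric $\frac{16M^2e^{-r/(2M)}}{r}\,dU\,dV+r^2(d\theta^2+\sin^2\theta\,d\phi^2)$, where $r=r(U,V)>0$ is determined by $(r-2M)e^{r/(2M)}=UV$. Regions: I is $\{U>0,V>0\}$, II is $\{U<0,V>0\}$, I$'$ is $\{U<0,V<0\}$, II$'$ is $\{U>0,V<0\}$. Spherically symmetric hypersurfaces are identified with curves in the $(U,V)$-plane; such a curve is $T$-axisymmetric if it is invariant under $\rho(U,V)=(-V,-U)$. For $H\in\mathbb{R}$ and $r\in(0,2M)$ let $k_H(r)=-Hr^3-r^{3/2}(2M-r)^{1/2}$ and $\tilde k_H(r)=-Hr^3+r^{3/2}(2M-r)^{1/2}$. The function $k_H$ has a unique minimum point $r_H$, with value $c_H<\min(0,-8M^3H)$, and is strictly increasing on $[r_H,2M)$;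 $\tilde k_H$ has a unique maximum point $R_H$, with value $C_H>\max(0,-8M^3H)$, and is strictly decreasing on $[R_H,2M)$. Both tend to $-8M^3H$ as $r\to 2M$. Write $A(x)=Hx^3+c$ and $D(x)=(Hx^3+c)^2+x^3(x-2M)$. For $c\in(c_H,-8M^3H)$ let $r^+_{H,c}\in(r_H,2M)$ be the solution of $k_H(r)=c$ in $(r_H,2M)$. The hypersurface $\Sigma^+_{H,c}$ (spacelike, of constant mean curvature $H$, $T$-axisymmetric, passing through regions I, II, I$'$) is the union of the curve $$V(r;c)=\exp\Big[\tfrac1{4M}\Big(r^+_{H,c}+2M\ln|r^+_{H,c}-2M|+\int_{r^+_{H,c}}^r\frac{x^4}{D(x)-A(x)\sqrt{D(x)}}\,dx\Big)\Big],\qquad U(r;c)=\frac{(r-2M)e^{r/(2M)}}{V(r;c)},\qquad r\ge r^+_{H,c},$$ (the part in $U+V\ge0$) and its image under $\rho$. For $c\in(-8M^3H,C_H)$ let $\tilde r^-_{H,c}\in(R_H,2M)$ be the solution of $\tilde k_H(r)=c$ in $(R_H,2M)$. The hypersurface $\tilde\Sigma^-_{H,c}$ (spacelike, of constant mean curvature $H$, $T$-axisymmetric, passing through regions I, II$'$, I$'$) is the union of the curve $$U(r;c)=\exp\Big[\tfrac1{4M}\Big(\tilde r^-_{H,c}+2M\ln|\tilde r^-_{H,c}-2M|+\int_{\tilde r^-_{H,c}}^r\frac{x^4}{D(x)+A(x)\sqrt{D(x)}}\,dx\Big)\Big],\qquad V(r;c)=\frac{(r-2M)e^{r/(2M)}}{U(r;c)},\qquad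 r\ge \tilde r^-_{H,c},$$ (the part in $U+V\ge0$) and its image under $\rho$. For $c=-8M^3H$ the corresponding hypersurface, written $\Sigma^+_{H,-8M^3H}=\tilde\Sigma^-_{H,-8M^3H}$, passes through the origin $(0,0)$ and is contained in the union of regions I, I$'$ and the origin (so it does not meet region II or II$'$): it is the union of $$U(r)=\sqrt{r-2M}\,e^{\frac1{4M}(-\int_{2M}^r\frac{A(x)}{h(x)\sqrt{D(x)}}dx+r)},\quad V(r)=\sqrt{r-2M}\,e^{\frac1{4M}(\int_{2M}^r\frac{A(x)}{h(x)\sqrt{D(x)}}dx+r)},\quad r\ge 2M,$$ and its image under $\rho$. *)

theory Defs
  imports "HOL-Analysis.Analysis" "HOL-Library.Disjoint_Sets"
begin

text \<open>
  Spherically symmetric hypersurfaces of the Kruskal extension of mass \<open>M > 0\<close> are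
  identified with curves in the \<open>(U,V)\<close>-plane, that is, with sets of type
  \<open>(real \<times> real) set\<close>. All definitions are meant for \<open>M > 0\<close>.
\<close>

definition kruskal_plane :: "real \<Rightarrow> (real \<times> real) set" where
  "kruskal_plane M = {(U, V). U * V > - 2 * M}"

text \<open>The solution \<open>r\<close> exists, and is then unique, exactly for \<open>p \<in> kruskal_plane M\<close>.\<close>

definition area_radius :: "real \<Rightarrow> real \<times> real \<Rightarrow> real" where
  "area_radius M p = (THE r. r > 0 \<and> (r - 2 * M) * exp (r / (2 * M)) = fst p * snd p)"

definition region_II :: "real \<Rightarrow> (real \<times> real) set" where
  "region_II M = {(U, V) \<in> kruskal_plane M. U < 0 \<and> V > 0}"

definition region_II' :: "real \<Rightarrow> (real \<times> real) set" where
  "region_II' M = {(U, V) \<in> kruskal_plane M. U > 0 \<and> V < 0}"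

definition T_reflection :: "real \<times> real \<Rightarrow> real \<times> real" where
  "T_reflection p = (- snd p, - fst p)"

definition k_fun :: "real \<Rightarrow> real \<Rightarrow> real \<Rightarrow> real" where
  "k_fun M H r = - H * r ^ 3 - r powr (3 / 2) * (2 * M - r) powr (1 / 2)"

definition k_tilde :: "real \<Rightarrow> real \<Rightarrow> real \<Rightarrow> real" where
  "k_tilde M H r = - H * r ^ 3 + r powr (3 / 2) * (2 * M - r) powr (1 / 2)"

definition r_min :: "real \<Rightarrow> real \<Rightarrow> real" where
  "r_min M H = (THE r. is_arg_min (k_fun M H) (\<lambda>s. s \<in> {0<..<2 * M}) r)"

definition c_min :: "real \<Rightarrow> real \<Rightarrow> real" where
  "c_min M H = k_fun M H (r_min M H)"

definition R_max :: "real \<Rightarrow> real \<Rightarrow> real" where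
  "R_max M H = (THE r. is_arg_max (k_tilde M H) (\<lambda>s. s \<in> {0<..<2 * M}) r)"

definition C_max :: "real \<Rightarrow> real \<Rightarrow> real" where
  "C_max M H = k_tilde M H (R_max M H)"

definition A_fun :: "real \<Rightarrow> real \<Rightarrow> real \<Rightarrow> real" where
  "A_fun H c x = H * x ^ 3 + c"

definition D_fun :: "real \<Rightarrow> real \<Rightarrow> real \<Rightarrow> real \<Rightarrow> real" where
  "D_fun M H c x = (H * x ^ 3 + c)\<^sup>2 + x ^ 3 * (x - 2 * M)"

definition h_fun :: "real \<Rightarrow> real \<Rightarrow> real" where
  "h_fun M r = 1 - 2 * M / r"

definition r_plus :: "real \<Rightarrow> real \<Rightarrow> real \<Rightarrow> real" where
  "r_plus M H c = (THE r. r \<in> {r_min M H<..<2 * M} \<and> k_fun M H r = c)"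

definition r_tilde_minus :: "real \<Rightarrow> real \<Rightarrow> real \<Rightarrow> real" where
  "r_tilde_minus M H c = (THE r. r \<in> {R_max M H<..<2 * M} \<and> k_tilde M H r = c)"

text \<open>
  All integrals below are singular at their lower limit \<open>a\<close>, where \<open>D\<close> vanishes
  (and, for \<open>critical_integral\<close>, \<open>h\<close> as well). For the admissible \<open>c\<close> the integrands have
  constant sign and grow only like \<open>(x - a) powr (- 1 / 2)\<close>, so the integrals converge and the
  totalised value of the integrand at \<open>a\<close> is irrelevant.
\<close>

definition V_plus :: "real \<Rightarrow> real \<Rightarrow> real \<Rightarrow> real \<Rightarrow> real" where
  "V_plus M H c r = exp (1 / (4 * M) *
     (r_plus M H c + 2 * M * ln \<bar>r_plus M H c - 2 * M\<bar> +
      integral {r_plus M H c..r}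
        (\<lambda>x. x ^ 4 / (D_fun M H c x - A_fun H c x * sqrt (D_fun M H c x)))))"

definition U_plus :: "real \<Rightarrow> real \<Rightarrow> real \<Rightarrow> real \<Rightarrow> real" where
  "U_plus M H c r = (r - 2 * M) * exp (r / (2 * M)) / V_plus M H c r"

definition U_tilde_minus :: "real \<Rightarrow> real \<Rightarrow> real \<Rightarrow> real \<Rightarrow> real" where
  "U_tilde_minus M H c r = exp (1 / (4 * M) *
     (r_tilde_minus M H c + 2 * M * ln \<bar>r_tilde_minus M H c - 2 * M\<bar> +
      integral {r_tilde_minus M H c..r}
        (\<lambda>x. x ^ 4 / (D_fun M H c x + A_fun H c x * sqrt (D_fun M H c x)))))"

definition V_tilde_minus :: "real \<Rightarrow> real \<Rightarrow> real \<Rightarrow> real \<Rightarrow> real" where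
  "V_tilde_minus M H c r = (r - 2 * M) * exp (r / (2 * M)) / U_tilde_minus M H c r"

definition critical_integral :: "real \<Rightarrow> real \<Rightarrow> real \<Rightarrow> real" where
  "critical_integral M H r = (let c = - 8 * M ^ 3 * H in
     integral {2 * M..r} (\<lambda>x. A_fun H c x / (h_fun M x * sqrt (D_fun M H c x))))"

definition U_critical :: "real \<Rightarrow> real \<Rightarrow> real \<Rightarrow> real" where
  "U_critical M H r = sqrt (r - 2 * M) * exp (1 / (4 * M) * (- critical_integral M H r + r))"

definition V_critical :: "real \<Rightarrow> real \<Rightarrow> real \<Rightarrow> real" where
  "V_critical M H r = sqrt (r - 2 * M) * exp (1 / (4 * M) * (critical_integral M H r + r))"

definition T_symmetrize :: "(real \<times> real) set \<Rightarrow> (real \<times> real) set" where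
  "T_symmetrize S = S \<union> T_reflection ` S"

definition Sigma_critical :: "real \<Rightarrow> real \<Rightarrow> (real \<times> real) set" where
  "Sigma_critical M H = T_symmetrize ((\<lambda>r. (U_critical M H r, V_critical M H r)) ` {2 * M..})"

text \<open>Meaningful for \<open>c_min M H < c \<le> - 8 * M ^ 3 * H\<close>.\<close>

definition Sigma_plus :: "real \<Rightarrow> real \<Rightarrow> real \<Rightarrow> (real \<times> real) set" where
  "Sigma_plus M H c =
     (if c = - 8 * M ^ 3 * H then Sigma_critical M H
      else T_symmetrize ((\<lambda>r. (U_plus M H c r, V_plus M H c r)) ` {r_plus M H c..}))"

text \<open>Meaningful for \<open>- 8 * M ^ 3 * H \<le> c < C_max M H\<close>.\<close>

definition Sigma_tilde_minus :: "real \<Rightarrow> real \<Rightarrow> real \<Rightarrow> (real \<times> real) set" where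
  "Sigma_tilde_minus M H c =
     (if c = - 8 * M ^ 3 * H then Sigma_critical M H
      else T_symmetrize
        ((\<lambda>r. (U_tilde_minus M H c r, V_tilde_minus M H c r)) ` {r_tilde_minus M H c..}))"

end

theory Submission imports Defs begin

text \<open>
  Part (ii) is part (i) for \<open>-H\<close>, \<open>-c\<close> with \<open>U\<close> and \<open>V\<close> exchanged. In region II the half of a
  slice starting at the throat \<open>\<rho>\<close>, \<open>c = k \<rho>\<close>, is the graph of
  \<open>2 * M * ln (V / - U) = F \<rho> r\<close>, where \<open>F \<rho> r\<close> is the integral over \<open>{\<rho>..r}\<close> of
  \<open>f c x = - x * A / ((2 * M - x) * sqrt D)\<close>, and the reflected half is the graph of \<open>- F\<close>. The slices
  thus foliate region II as soon as, for fixed \<open>r\<close>, the map \<open>\<rho> \<mapsto> F \<rho> r\<close> is continuous and strictly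
  decreasing from \<open>\<infinity>\<close> (at \<open>r_H\<close>, where \<open>D\<close> acquires a double zero) to \<open>0\<close> (at \<open>\<rho> = r\<close>).

  Monotonicity expresses that the lapse of the variation in \<open>c\<close>, which is even along the slice and
  solves the lapse equation with the nonnegative potential \<open>3 * H\<^sup>2 + 6 * c\<^sup>2 / x ^ 6\<close> (the squared
  second fundamental form), cannot vanish. Explicitly, with \<open>Q = D / x ^ 4\<close> and
  \<open>m = x\<^sup>2 * Q' / 2\<close>, the potential makes \<open>m\<close> increasing in \<open>x\<close>, hence positive, and
  \<open>df/dc = 1 / (x\<^sup>2 * sqrt Q ^ 3)\<close> is at most the \<open>x\<close>-derivative of \<open>- 1 / (m * sqrt Q)\<close>; the
  boundary term at the throat cancels against the motion of the throat.
\<close>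

subsection \<open>Real functions\<close>

text \<open>By \<open>f_eq\<close>, at fixed \<open>x\<close> the integrand depends on
  \<open>c\<close> only through this ratio, with \<open>s = a c x\<close> and \<open>g\<close> the
  value \<open>g x\<close>. The derivative is negative and increases with \<open>s\<close>, so the
  ratio is decreasing and convex.\<close>

lemma ratio_deriv:
  fixes a g :: real
  assumes "0 < g" "g < a"
  shows "((\<lambda>s. s / sqrt (s\<^sup>2 - g\<^sup>2)) has_real_derivative - (g\<^sup>2 / sqrt (a\<^sup>2 - g\<^sup>2) ^ 3)) (at a)"
proof -
  have p: "0 < a\<^sup>2 - g\<^sup>2" using assms by (simp add: power_strict_mono)
  define q where "q = sqrt (a\<^sup>2 - g\<^sup>2)"
  have q: "q > 0" "q\<^sup>2 = a\<^sup>2 - g\<^sup>2" using p by (auto simp: q_def)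
  have "((\<lambda>s. s / sqrt (s\<^sup>2 - g\<^sup>2)) has_real_derivative (1 * q - a * (2 * a * (inverse q / 2))) / (q * q)) (at a)"
    unfolding q_def
    by (rule derivative_eq_intros refl | use p in force)+
  moreover have "(1 * q - a * (2 * a * (inverse q / 2))) / (q * q) = - (g\<^sup>2 / q ^ 3)"
  proof -
    have "1 * q - a * (2 * a * (inverse q / 2)) = - g\<^sup>2 / q"
      using q by (simp add: divide_simps) (simp add: power2_eq_square)
    then show ?thesis by (simp add: power3_eq_cube)
  qed
  ultimately show ?thesis by (simp add: q_def)
qed

lemma ratio_mvt:
  fixes a1 a2 g :: real
  assumes "0 < g" "g < a2" "a2 < a1"
  obtains z where "a2 < z" "z < a1"
    "a2 / sqrt (a2\<^sup>2 - g\<^sup>2) - a1 / sqrt (a1\<^sup>2 - g\<^sup>2) = (a1 - a2) * (g\<^sup>2 / sqrt (z\<^sup>2 - g\<^sup>2) ^ 3)"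
proof -
  have "\<exists>z>a2. z < a1 \<and> a1 / sqrt (a1\<^sup>2 - g\<^sup>2) - a2 / sqrt (a2\<^sup>2 - g\<^sup>2) = (a1 - a2) * - (g\<^sup>2 / sqrt (z\<^sup>2 - g\<^sup>2) ^ 3)"
    by (rule MVT2[OF assms(3)]) (rule ratio_deriv, use assms in auto)
  then show thesis using that by (auto simp: algebra_simps)
qed

lemma ratio_strict_antimono:
  fixes a1 a2 g :: real
  assumes "0 < g" "g < a2" "a2 < a1"
  shows "a1 / sqrt (a1\<^sup>2 - g\<^sup>2) < a2 / sqrt (a2\<^sup>2 - g\<^sup>2)"
proof -
  obtain z where z: "a2 < z" "z < a1"
    "a2 / sqrt (a2\<^sup>2 - g\<^sup>2) - a1 / sqrt (a1\<^sup>2 - g\<^sup>2) = (a1 - a2) * (g\<^sup>2 / sqrt (z\<^sup>2 - g\<^sup>2) ^ 3)"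
    by (rule ratio_mvt[OF assms])
  have "g\<^sup>2 < z\<^sup>2" using assms z by (simp add: power_strict_mono)
  then have "0 < (a1 - a2) * (g\<^sup>2 / sqrt (z\<^sup>2 - g\<^sup>2) ^ 3)"
    using assms by (intro mult_pos_pos divide_pos_pos zero_less_power) auto
  then show ?thesis using z(3) by linarith
qed

text \<open>By convexity the slope is steepest at the smaller argument \<open>a2\<close>, so it
  bounds the whole secant.\<close>

lemma ratio_tangent:
  fixes a1 a2 g :: real
  assumes "0 < g" "g < a2" "a2 \<le> a1"
  shows "a2 / sqrt (a2\<^sup>2 - g\<^sup>2) - a1 / sqrt (a1\<^sup>2 - g\<^sup>2) \<le> (a1 - a2) * (g\<^sup>2 / sqrt (a2\<^sup>2 - g\<^sup>2) ^ 3)"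
proof (cases "a2 = a1")
  case False
  then have "a2 < a1" using assms by simp
  then obtain z where z: "a2 < z" "z < a1"
    "a2 / sqrt (a2\<^sup>2 - g\<^sup>2) - a1 / sqrt (a1\<^sup>2 - g\<^sup>2) = (a1 - a2) * (g\<^sup>2 / sqrt (z\<^sup>2 - g\<^sup>2) ^ 3)"
    using ratio_mvt[OF assms(1,2)] by blast
  have "g\<^sup>2 < a2\<^sup>2" "a2\<^sup>2 \<le> z\<^sup>2" using assms z by (auto simp: power_strict_mono power_mono)
  then have "g\<^sup>2 / sqrt (z\<^sup>2 - g\<^sup>2) ^ 3 \<le> g\<^sup>2 / sqrt (a2\<^sup>2 - g\<^sup>2) ^ 3"
    by (intro divide_left_mono power_mono mult_pos_pos zero_less_power) auto
  then show ?thesis unfolding z(3) using \<open>a2 < a1\<close> by (intro mult_left_mono) auto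
qed auto

lemma inverse_sqrt_has_integral:
  fixes a b :: real
  assumes "a \<le> b"
  shows "((\<lambda>x. 1 / sqrt (x - a)) has_integral 2 * sqrt (b - a)) {a..b}"
proof -
  have "((\<lambda>x. 1 / sqrt (x - a)) has_integral 2 * sqrt (b - a) - 2 * sqrt (a - a)) {a..b}"
  proof (rule fundamental_theorem_of_calculus_interior[OF assms])
    show "continuous_on {a..b} (\<lambda>x. 2 * sqrt (x - a))"
      by (intro continuous_intros)
    show "((\<lambda>x. 2 * sqrt (x - a)) has_vector_derivative 1 / sqrt (x - a)) (at x)"
      if "x \<in> {a<..<b}" for x
      unfolding has_real_derivative_iff_has_vector_derivative[symmetric]
      by (rule derivative_eq_intros refl | use that in \<open>force simp: divide_simps\<close>)+
  qed
  then show ?thesis by simp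
qed

text \<open>At a throat the integrands blow up like an inverse square root. Measurability and the
  integrable majorant give integrability without any control of the value at
  \<open>a\<close>.\<close>

lemma integrable_inverse_sqrt_singularity:
  fixes f :: "real \<Rightarrow> real"
  assumes "a \<le> b" and cont: "continuous_on {a<..b} f"
    and bound: "\<And>x. x \<in> {a<..b} \<Longrightarrow> 0 \<le> f x \<and> f x \<le> K / sqrt (x - a)"
  shows "f integrable_on {a..b}" "0 \<le> integral {a..b} f" "integral {a..b} f \<le> 2 * K * sqrt (b - a)"
proof -
  have maj: "((\<lambda>x. K / sqrt (x - a)) has_integral 2 * K * sqrt (b - a)) {a..b}"
    using has_integral_mult_right[OF inverse_sqrt_has_integral[OF assms(1)], of K]
    by (simp add: mult_ac)
  have maj': "((\<lambda>x. K / sqrt (x - a)) has_integral 2 * K * sqrt (b - a)) {a<..b}"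
    by (rule has_integral_spike_set_eq[THEN iffD1, OF _ _ maj])
      (auto intro: negligible_subset[of "{a}"])
  have "f integrable_on {a<..b}"
  proof (rule measurable_bounded_by_integrable_imp_integrable)
    show "f \<in> borel_measurable (lebesgue_on {a<..b})"
      by (rule continuous_imp_measurable_on_sets_lebesgue[OF cont]) auto
    show "(\<lambda>x. K / sqrt (x - a)) integrable_on {a<..b}" using maj' by blast
  qed (use bound in auto)
  then show int: "f integrable_on {a..b}"
    by (rule integrable_spike_set) (auto intro: negligible_subset[of "{a}"])
  have spike: "integral {a..b} f = integral {a<..b} f"
    by (rule integral_spike_set) (auto intro: negligible_subset[of "{a}"])
  show "0 \<le> integral {a..b} f"
    unfolding spike using bound by (intro integral_nonneg \<open>f integrable_on {a<..b}\<close>) auto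
  show "integral {a..b} f \<le> 2 * K * sqrt (b - a)"
    unfolding spike using \<open>f integrable_on {a<..b}\<close> bound
    by (intro has_integral_le[OF integrable_integral maj']) auto
qed

text \<open>By compactness the gap \<open>g - f\<close> has a positive minimum, which is then
  integrated.\<close>

lemma integral_strict_mono:
  fixes f g :: "real \<Rightarrow> real"
  assumes "a < b" "continuous_on {a..b} f" "continuous_on {a..b} g"
    and "\<And>x. x \<in> {a..b} \<Longrightarrow> f x < g x"
  shows "integral {a..b} f < integral {a..b} g"
proof -
  obtain z where z: "z \<in> {a..b}" "\<And>x. x \<in> {a..b} \<Longrightarrow> g z - f z \<le> g x - f x"
    using continuous_attains_inf[OF _ _ continuous_on_diff[OF assms(3,2)]] assms(1) by force
  have "0 < (g z - f z) * (b - a)" using assms z(1) by (intro mult_pos_pos) auto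
  also have "\<dots> = integral {a..b} (\<lambda>x. g z - f z)" using assms(1) by simp
  also have "\<dots> \<le> integral {a..b} (\<lambda>x. g x - f x)"
    using z assms by (intro integral_le integrable_continuous_interval continuous_intros) auto
  also have "\<dots> = integral {a..b} g - integral {a..b} f"
    using assms by (intro integral_diff integrable_continuous_interval)
  finally show ?thesis by simp
qed

text \<open>At the throat \<open>f\<close> takes the default value \<open>0\<close> of a division by
  zero, so comparisons must leave out the left endpoint.\<close>

lemma integral_mono_except_left:
  fixes f g :: "real \<Rightarrow> real"
  assumes "f integrable_on {a..b}" "g integrable_on {a..b}" "\<And>x. x \<in> {a<..b} \<Longrightarrow> f x \<le> g x"
  shows "integral {a..b} f \<le> integral {a..b} g"
proof -
  define h where "h x = (if x = a then f x else g x)" for x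
  have "h integrable_on {a..b}"
    by (rule integrable_spike_finite[OF finite.insertI[OF finite.emptyI] _ assms(2), of a])
      (simp add: h_def)
  moreover have "integral {a..b} h = integral {a..b} g"
    by (rule integral_spike[of "{a}"]) (auto simp: h_def)
  moreover have "f x \<le> h x" if "x \<in> {a..b}" for x
    using assms(3)[of x] that by (auto simp: h_def)
  ultimately show ?thesis using integral_le[OF assms(1), of h] by simp
qed

subsection \<open>The constants of a slice\<close>

locale kruskal =
  fixes M H :: real
  assumes M_pos: "M > 0"
begin

text \<open>For \<open>0 \<le> x \<le> 2 * M\<close> one has
  \<open>D = a\<^sup>2 - g\<^sup>2\<close> and \<open>a - g = k x - c\<close>, so a throat is a
  point where \<open>a = g\<close>.\<close>

definition g :: "real \<Rightarrow> real" where "g x = sqrt (x ^ 3 * (2 * M - x))"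
definition k :: "real \<Rightarrow> real" where "k x = - H * x ^ 3 - g x"
text \<open>\<open>nu\<close> carries the sign of the derivative of \<open>k\<close> and is also the
  value of \<open>m\<close> at a throat (\<open>k_deriv\<close>, \<open>m_k\<close>).\<close>

definition nu :: "real \<Rightarrow> real" where "nu x = 2 * x - 3 * M - 3 * H * g x"
definition a :: "real \<Rightarrow> real \<Rightarrow> real" where "a c x = - c - H * x ^ 3"
definition Q :: "real \<Rightarrow> real \<Rightarrow> real" where "Q c x = 1 - 2 * M / x + (a c x / x\<^sup>2)\<^sup>2"
definition m :: "real \<Rightarrow> real \<Rightarrow> real" where "m c x = M - a c x * (H - 2 * c / x ^ 3)"
definition f :: "real \<Rightarrow> real \<Rightarrow> real" where "f c x = a c x / (x * (2 * M - x) * sqrt (Q c x))"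
definition F :: "real \<Rightarrow> real \<Rightarrow> real" where "F \<rho> r = integral {\<rho>..r} (f (k \<rho>))"
abbreviation rH :: real where "rH \<equiv> r_min M H"

section \<open>Algebraic relations between the coefficients\<close>

lemma g_pos: "0 < x \<Longrightarrow> x < 2 * M \<Longrightarrow> 0 < g x"
  by (simp add: g_def)

lemma g_sq: "0 \<le> x \<Longrightarrow> x \<le> 2 * M \<Longrightarrow> (g x)\<^sup>2 = x ^ 3 * (2 * M - x)"
  by (simp add: g_def)

lemma k_fun_eq: "0 \<le> x \<Longrightarrow> x \<le> 2 * M \<Longrightarrow> k_fun M H x = k x"
proof -
  assume x: "0 \<le> x" "x \<le> 2 * M"
  have "x powr (3 / 2) = sqrt (x ^ 3)"
  proof (cases "x = 0")
    case False
    then have "x powr (3 / 2) = (x ^ 3) powr (1 / 2)"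
      using x by (simp add: powr_powr flip: powr_numeral)
    then show ?thesis using x by (simp add: powr_half_sqrt)
  qed auto
  then show ?thesis
    using x by (simp add: k_fun_def k_def g_def powr_half_sqrt real_sqrt_mult)
qed

lemma D_fun_eq: "0 < x \<Longrightarrow> D_fun M H c x = x ^ 4 * Q c x"
  by (simp add: D_fun_def Q_def a_def power_divide divide_simps) algebra

lemma Q_factor:
  assumes "0 < x" "x \<le> 2 * M"
  shows "Q c x = ((a c x)\<^sup>2 - (g x)\<^sup>2) / x ^ 4"
  using assms by (simp add: g_sq Q_def power_divide divide_simps) algebra

lemma a_eq: "a c x = k x - c + g x"
  by (simp add: a_def k_def)

lemma Q_pos: "0 < x \<Longrightarrow> x < 2 * M \<Longrightarrow> c < k x \<Longrightarrow> 0 < Q c x"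
  using g_pos[of x] by (simp add: Q_factor a_eq power_strict_mono)

lemma Q_k: "0 < x \<Longrightarrow> x \<le> 2 * M \<Longrightarrow> Q (k x) x = 0"
  by (simp add: Q_factor a_eq)

lemma f_eq:
  assumes "0 < x" "x < 2 * M"
  shows "f c x = x / (2 * M - x) * (a c x / sqrt ((a c x)\<^sup>2 - (g x)\<^sup>2))"
proof -
  have "sqrt (x ^ 4) = x\<^sup>2" by (rule real_sqrt_unique) auto
  then show ?thesis
    using assms by (simp add: f_def Q_factor real_sqrt_divide power2_eq_square)
qed

section \<open>The turning point of \<open>k\<close>\<close>

lemma g_deriv:
  assumes "0 < x" "x < 2 * M"
  shows "(g has_real_derivative x\<^sup>2 * (3 * M - 2 * x) / g x) (at x)"
proof -
  have p: "0 < x ^ 3 * (2 * M - x)" using assms by simp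
  have "(g has_real_derivative (3 * x\<^sup>2 * (2 * M - x) - x ^ 3) * (inverse (g x) / 2)) (at x)"
    unfolding g_def [abs_def] g_def
    by (rule derivative_eq_intros refl | use p in \<open>force simp: power2_eq_square power3_eq_cube\<close>)+
  moreover have "(3 * x\<^sup>2 * (2 * M - x) - x ^ 3) * (inverse (g x) / 2) = x\<^sup>2 * (3 * M - 2 * x) / g x"
    by (simp add: divide_simps) algebra
  ultimately show ?thesis by simp
qed

lemma k_deriv:
  assumes "0 < x" "x < 2 * M"
  shows "(k has_real_derivative x\<^sup>2 * nu x / g x) (at x)"
proof -
  have "(k has_real_derivative - H * (3 * x\<^sup>2) - x\<^sup>2 * (3 * M - 2 * x) / g x) (at x)"
    unfolding k_def [abs_def]
    by (rule derivative_eq_intros g_deriv assms refl | simp)+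
  moreover have "- H * (3 * x\<^sup>2) - x\<^sup>2 * (3 * M - 2 * x) / g x = x\<^sup>2 * nu x / g x"
    using g_pos[OF assms] by (simp add: nu_def field_simps)
  ultimately show ?thesis by simp
qed

lemma continuous_on_g: "continuous_on S g"
  unfolding g_def [abs_def] by (intro continuous_intros)

lemma continuous_on_k: "continuous_on S k"
  unfolding k_def [abs_def] by (intro continuous_intros continuous_on_g)

lemma continuous_on_nu: "continuous_on S nu"
  unfolding nu_def [abs_def] by (intro continuous_intros continuous_on_g)

text \<open>Division by \<open>g\<close> turns the \<open>H\<close> term of \<open>nu\<close> into a
  constant. The remaining quotient increases: the numerator of its derivative is
  \<open>2 * g\<close> plus a nonnegative square term.\<close>

lemma nu_over_g_less:
  assumes "0 < x" "x < y" "y < 2 * M"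
  shows "nu x / g x < nu y / g y"
proof -
  have "(2 * x - 3 * M) / g x < (2 * y - 3 * M) / g y"
  proof (rule DERIV_pos_imp_increasing[OF assms(2)], intro exI conjI)
    fix z assume "x \<le> z" "z \<le> y"
    then have z: "0 < z" "z < 2 * M" using assms by auto
    show "((\<lambda>x. (2 * x - 3 * M) / g x) has_real_derivative
        (2 * g z - (2 * z - 3 * M) * (z\<^sup>2 * (3 * M - 2 * z) / g z)) / (g z * g z)) (at z)"
      using g_pos[OF z] by (auto intro!: derivative_eq_intros g_deriv z)
    have "(2 * z - 3 * M) * (z\<^sup>2 * (3 * M - 2 * z) / g z) = - (z\<^sup>2 * (2 * z - 3 * M)\<^sup>2 / g z)"
      by (simp add: power2_eq_square divide_simps) algebra
    moreover have "0 \<le> z\<^sup>2 * (2 * z - 3 * M)\<^sup>2 / g z"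
      using g_pos[OF z] by (intro divide_nonneg_pos) auto
    ultimately have "0 < 2 * g z - (2 * z - 3 * M) * (z\<^sup>2 * (3 * M - 2 * z) / g z)"
      using g_pos[OF z] by linarith
    then show "0 < (2 * g z - (2 * z - 3 * M) * (z\<^sup>2 * (3 * M - 2 * z) / g z)) / (g z * g z)"
      using g_pos[OF z] by simp
  qed
  moreover have "nu z / g z = (2 * z - 3 * M) / g z - 3 * H" if "0 < z" "z < 2 * M" for z
    using g_pos[OF that] by (simp add: nu_def field_simps)
  ultimately show ?thesis using assms by simp
qed

lemma turning_point_exists:
  obtains r0 where "0 < r0" "r0 < 2 * M" "\<And>x. 0 < x \<Longrightarrow> x < r0 \<Longrightarrow> nu x < 0"
    "nu r0 = 0" "\<And>x. r0 < x \<Longrightarrow> x < 2 * M \<Longrightarrow> 0 < nu x"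
proof -
  \<comment> \<open>\<open>g\<close> vanishes at both ends, leaving \<open>- 3 * M\<close> and
    \<open>M\<close> for every \<open>H\<close>.\<close>
  have ends: "nu 0 < 0" "0 < nu (2 * M)" using M_pos by (simp_all add: nu_def g_def)
  obtain r0 where "0 \<le> r0" "r0 \<le> 2 * M" "nu r0 = 0"
    using IVT'[of nu 0 0 "2 * M"] ends M_pos continuous_on_nu by auto
  with ends have r0: "0 < r0" "r0 < 2 * M" "nu r0 = 0"
    by (auto simp: less_le)
  show thesis
  proof (rule that[OF r0(1,2) _ r0(3)])
    show "nu x < 0" if "0 < x" "x < r0" for x
      using nu_over_g_less[of x r0] r0 that g_pos[of x]
      by (simp add: divide_less_0_iff)
    show "0 < nu x" if "r0 < x" "x < 2 * M" for x
      using nu_over_g_less[of r0 x] r0 that g_pos[of x]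
      by (simp add: zero_less_divide_iff)
  qed
qed

lemma turning_point_minimum:
  assumes r0: "0 < r0" "r0 < 2 * M" "\<And>x. 0 < x \<Longrightarrow> x < r0 \<Longrightarrow> nu x < 0"
     "\<And>x. r0 < x \<Longrightarrow> x < 2 * M \<Longrightarrow> 0 < nu x"
  shows "x \<in> {0<..<2 * M} \<Longrightarrow> x \<noteq> r0 \<Longrightarrow> k r0 < k x"
    and "r0 \<le> x \<Longrightarrow> x < y \<Longrightarrow> y \<le> 2 * M \<Longrightarrow> k x < k y"
proof -
  show inc: "k x < k y" if "r0 \<le> x" "x < y" "y \<le> 2 * M" for x y
  proof (rule DERIV_pos_imp_increasing_open[OF that(2) _ continuous_on_k], intro exI conjI)
    fix z assume z: "x < z" "z < y"
    show "(k has_real_derivative z\<^sup>2 * nu z / g z) (at z)"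
      using z that r0 by (intro k_deriv) auto
    show "0 < z\<^sup>2 * nu z / g z"
      using z that r0 g_pos[of z] by (intro divide_pos_pos mult_pos_pos) auto
  qed
  show "k r0 < k x" if "x \<in> {0<..<2 * M}" "x \<noteq> r0" for x
  proof (cases "r0 < x")
    case False
    with that have x: "0 < x" "x < r0" by auto
    show ?thesis
    proof (rule DERIV_neg_imp_decreasing_open[OF x(2) _ continuous_on_k], intro exI conjI)
      fix z assume z: "x < z" "z < r0"
      show "(k has_real_derivative z\<^sup>2 * nu z / g z) (at z)"
        using z x r0 by (intro k_deriv) auto
      show "z\<^sup>2 * nu z / g z < 0"
        using z x r0 g_pos[of z] by (intro divide_neg_pos mult_pos_neg) auto
    qed
  qed (use inc that in auto)
qed

lemma r_min_turning:
  shows rH_pos: "0 < rH" and rH_less: "rH < 2 * M" and nu_rH: "nu rH = 0"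
    and nu_pos: "rH < x \<Longrightarrow> x < 2 * M \<Longrightarrow> 0 < nu x"
    and k_strict_mono: "rH \<le> x \<Longrightarrow> x < y \<Longrightarrow> y \<le> 2 * M \<Longrightarrow> k x < k y"
proof -
  obtain r0 where r0: "0 < r0" "r0 < 2 * M" "\<And>x. 0 < x \<Longrightarrow> x < r0 \<Longrightarrow> nu x < 0"
    "nu r0 = 0" "\<And>x. r0 < x \<Longrightarrow> x < 2 * M \<Longrightarrow> 0 < nu x"
    by (rule turning_point_exists) blast
  have min: "k r0 < k x" if "x \<in> {0<..<2 * M}" "x \<noteq> r0" for x
    by (rule turning_point_minimum(1)[of r0]) (use r0 that in auto)
  have inc: "k x < k y" if "r0 \<le> x" "x < y" "y \<le> 2 * M" for x y
    by (rule turning_point_minimum(2)[of r0]) (use r0 that in auto)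
  have "rH = r0" unfolding r_min_def
  proof (rule the_equality)
    show "is_arg_min (k_fun M H) (\<lambda>s. s \<in> {0<..<2 * M}) r0"
      unfolding is_arg_min_def
    proof (intro conjI notI)
      assume "\<exists>y. y \<in> {0<..<2 * M} \<and> k_fun M H y < k_fun M H r0"
      then obtain y where y: "y \<in> {0<..<2 * M}" "k_fun M H y < k_fun M H r0" by blast
      then have "k y < k r0" using r0(1,2) by (simp add: k_fun_eq)
      then show False using min[OF y(1)] by auto
    qed (use r0 in auto)
    show "r = r0" if "is_arg_min (k_fun M H) (\<lambda>s. s \<in> {0<..<2 * M}) r" for r
    proof (rule ccontr)
      assume "r \<noteq> r0"
      from that r0(1,2) have "r \<in> {0<..<2 * M}" "\<not> k_fun M H r0 < k_fun M H r"
        by (auto simp: is_arg_min_def)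
      then show False using min[OF _ \<open>r \<noteq> r0\<close>] r0(1,2) by (simp add: k_fun_eq)
    qed
  qed
  with r0 inc show "0 < rH" "rH < 2 * M" "nu rH = 0"
    "rH < x \<Longrightarrow> x < 2 * M \<Longrightarrow> 0 < nu x"
    "rH \<le> x \<Longrightarrow> x < y \<Longrightarrow> y \<le> 2 * M \<Longrightarrow> k x < k y"
    by auto
qed

lemma c_min_eq: "c_min M H = k rH"
  using rH_pos rH_less by (simp add: c_min_def k_fun_eq)

lemma k_mono: "rH \<le> x \<Longrightarrow> x \<le> y \<Longrightarrow> y \<le> 2 * M \<Longrightarrow> k x \<le> k y"
  using k_strict_mono[of x y] by (cases "x = y") auto

lemma k_horizon: "k (2 * M) = - 8 * M ^ 3 * H"
  by (simp add: k_def g_def power_mult_distrib)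

lemma r_plus_k:
  assumes "rH < \<rho>" "\<rho> < 2 * M"
  shows "r_plus M H (k \<rho>) = \<rho>"
  unfolding r_plus_def
proof (rule the_equality)
  show "\<rho> \<in> {rH<..<2 * M} \<and> k_fun M H \<rho> = k \<rho>"
    using assms rH_pos by (auto simp: k_fun_eq)
  show "r = \<rho>" if "r \<in> {rH<..<2 * M} \<and> k_fun M H r = k \<rho>" for r
    using that assms rH_pos k_strict_mono[of r \<rho>] k_strict_mono[of \<rho> r]
    by (cases r \<rho> rule: linorder_cases) (auto simp: k_fun_eq)
qed

lemma k_inverse:
  assumes "k rH < c" "c < k x" "rH \<le> x" "x \<le> 2 * M"
  obtains \<rho> where "rH < \<rho>" "\<rho> < x" "k \<rho> = c"
proof -
  obtain \<rho> where "rH \<le> \<rho>" "\<rho> \<le> x" "k \<rho> = c"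
    using IVT'[of k rH c x] assms continuous_on_k by auto
  with assms that[of \<rho>] show thesis by (auto simp: less_le)
qed

section \<open>Growth of \<open>m\<close> and \<open>Q\<close> beyond the throat\<close>

lemma Q_deriv:
  assumes "0 < x"
  shows "(Q c has_real_derivative 2 * m c x / x\<^sup>2) (at x)"
proof -
  have "(Q c has_real_derivative 2 * M / (x * x) + 2 * (a c x / x\<^sup>2) *
      ((- (H * (3 * x\<^sup>2)) * x\<^sup>2 - a c x * (2 * x)) / (x\<^sup>2 * x\<^sup>2))) (at x)"
    unfolding Q_def [abs_def] a_def
    by (rule derivative_eq_intros refl | use assms in \<open>simp add: mult_ac\<close>)+
  moreover have "2 * M / (x * x) + 2 * (a c x / x\<^sup>2) *
      ((- (H * (3 * x\<^sup>2)) * x\<^sup>2 - a c x * (2 * x)) / (x\<^sup>2 * x\<^sup>2)) = 2 * m c x / x\<^sup>2"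
    using assms by (simp add: m_def a_def divide_simps power2_eq_square power3_eq_cube) algebra
  ultimately show ?thesis by simp
qed

text \<open>The derivative is \<open>x\<^sup>2\<close> times the lapse potential
  \<open>3 * H\<^sup>2 + 6 * c\<^sup>2 / x ^ 6\<close>, hence nonnegative for either sign of
  \<open>H\<close> and \<open>c\<close>.\<close>

lemma m_deriv:
  assumes "0 < x"
  shows "(m c has_real_derivative 3 * H\<^sup>2 * x\<^sup>2 + 6 * c\<^sup>2 / x ^ 4) (at x)"
proof -
  have "(m c has_real_derivative - (- (H * (3 * x\<^sup>2)) * (H - 2 * c / x ^ 3)
      + (6 * c * x\<^sup>2 / (x ^ 3 * x ^ 3)) * a c x)) (at x)"
    unfolding m_def [abs_def] a_def
    by (rule derivative_eq_intros refl | use assms in \<open>force simp: power2_eq_square\<close>)+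
  moreover have "- (- (H * (3 * x\<^sup>2)) * (H - 2 * c / x ^ 3)
      + (6 * c * x\<^sup>2 / (x ^ 3 * x ^ 3)) * a c x) = 3 * H\<^sup>2 * x\<^sup>2 + 6 * c\<^sup>2 / x ^ 4"
    using assms by (simp add: a_def divide_simps) algebra
  ultimately show ?thesis by simp
qed

lemma m_mono:
  assumes "0 < x" "x \<le> y"
  shows "m c x \<le> m c y"
proof (rule DERIV_nonneg_imp_nondecreasing[OF assms(2)], intro exI conjI)
  fix z assume "x \<le> z" "z \<le> y"
  then show "(m c has_real_derivative 3 * H\<^sup>2 * z\<^sup>2 + 6 * c\<^sup>2 / z ^ 4) (at z)"
    using assms by (intro m_deriv) auto
qed auto

text \<open>At the throat \<open>a = g\<close>, and
  \<open>(g x)\<^sup>2 = x ^ 3 * (2 * M - x)\<close> reduces \<open>m\<close> to \<open>nu\<close>.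
  Positivity of \<open>m\<close> further out thus starts from the monotonicity of
  \<open>k\<close>.\<close>

lemma m_k:
  assumes "0 < x" "x \<le> 2 * M"
  shows "m (k x) x = nu x"
proof -
  have "m (k x) x = M - 3 * H * g x - 2 * (g x)\<^sup>2 / x ^ 3"
    using assms(1) by (simp add: m_def a_def k_def divide_simps) algebra
  then show ?thesis
    using assms by (simp add: g_sq nu_def)
qed

lemma m_ge_nu:
  assumes "rH \<le> \<rho>" "\<rho> \<le> x" "\<rho> \<le> 2 * M"
  shows "nu \<rho> \<le> m (k \<rho>) x"
  using m_mono[of \<rho> x "k \<rho>"] m_k[of \<rho>] assms rH_pos by simp

text \<open>\<open>m\<close> does not decrease in \<open>x\<close>, and it starts with the value
  \<open>nu \<rho> > 0\<close> at the throat \<open>\<rho>\<close> with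
  \<open>k \<rho> = c\<close>.\<close>

lemma m_pos:
  assumes "k rH < c" "c \<le> k x" "rH < x" "x < 2 * M"
  shows "0 < m c x"
proof (cases "c = k x")
  case True
  then show ?thesis using m_k[of x] nu_pos[of x] assms rH_pos by simp
next
  case False
  then obtain \<rho> where "rH < \<rho>" "\<rho> < x" "k \<rho> = c"
    using k_inverse[of c x] assms by auto
  then show ?thesis using m_ge_nu[of \<rho> x] nu_pos[of \<rho>] assms by auto
qed

text \<open>The zero of \<open>Q\<close> at \<open>\<rho>\<close> is simple: its derivative
  \<open>2 * m / x\<^sup>2\<close> is at least
  \<open>2 * nu \<rho> / (2 * M)\<^sup>2\<close>.\<close>

lemma Q_lower:
  assumes \<rho>: "rH < \<rho>" "\<rho> \<le> x" "x < 2 * M"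
  shows "nu \<rho> / (2 * M\<^sup>2) * (x - \<rho>) \<le> Q (k \<rho>) x"
proof -
  define n where "n = nu \<rho> / (2 * M\<^sup>2)"
  have "Q (k \<rho>) \<rho> - n * (\<rho> - \<rho>) \<le> Q (k \<rho>) x - n * (x - \<rho>)"
  proof (rule DERIV_nonneg_imp_nondecreasing[OF \<rho>(2)], intro exI conjI)
    fix z assume "\<rho> \<le> z" "z \<le> x"
    then have z: "0 < z" "rH < z" "z < 2 * M" using \<rho> rH_pos by auto
    show "((\<lambda>x. Q (k \<rho>) x - n * (x - \<rho>)) has_real_derivative
        2 * m (k \<rho>) z / z\<^sup>2 - n) (at z)"
      by (auto intro!: derivative_eq_intros Q_deriv z)
    have "n = 2 * nu \<rho> / (2 * M)\<^sup>2" by (simp add: n_def power2_eq_square)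
    also have "\<dots> \<le> 2 * m (k \<rho>) z / z\<^sup>2"
      using z \<open>\<rho> \<le> z\<close> m_ge_nu[of \<rho> z] nu_pos[of \<rho>] \<rho>
      by (intro frac_le power_mono) auto
    finally show "0 \<le> 2 * m (k \<rho>) z / z\<^sup>2 - n" by simp
  qed
  then show ?thesis using Q_k[of \<rho>] \<rho> rH_pos by (simp add: n_def)
qed

text \<open>For \<open>c = k rH\<close> both \<open>Q\<close> and \<open>m\<close> vanish at
  \<open>rH\<close>. Integrating an upper bound on the derivative of \<open>m\<close> twice makes
  \<open>Q\<close> at most quadratic in the distance.\<close>

lemma Q_upper:
  assumes x: "rH \<le> x" "x < 2 * M"
  shows "Q (k rH) x \<le> (12 * H\<^sup>2 * M\<^sup>2 + 6 * (k rH)\<^sup>2 / rH ^ 4) / rH\<^sup>2 * (x - rH)\<^sup>2"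
proof -
  \<comment> \<open>An upper bound for the derivative of \<open>m\<close>, from
    \<open>z < 2 * M\<close> in its first term and \<open>z \<ge> rH\<close> in its second.\<close>
  define L where "L = 12 * H\<^sup>2 * M\<^sup>2 + 6 * (k rH)\<^sup>2 / rH ^ 4"
  have m_le: "m (k rH) y \<le> L * (y - rH)" if y: "rH \<le> y" "y < 2 * M" for y
  proof -
    have "m (k rH) y - L * (y - rH) \<le> m (k rH) rH - L * (rH - rH)"
    proof (rule DERIV_nonpos_imp_nonincreasing[OF y(1)], intro exI conjI)
      fix z assume "rH \<le> z" "z \<le> y"
      then have z: "0 < z" "rH \<le> z" "z < 2 * M" using y rH_pos by auto
      show "((\<lambda>y. m (k rH) y - L * (y - rH)) has_real_derivative
          (3 * H\<^sup>2 * z\<^sup>2 + 6 * (k rH)\<^sup>2 / z ^ 4) - L) (at z)"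
        by (auto intro!: derivative_eq_intros m_deriv z)
      have "3 * H\<^sup>2 * z\<^sup>2 \<le> 3 * H\<^sup>2 * (2 * M)\<^sup>2"
        using z by (intro mult_left_mono power_mono) auto
      moreover have "6 * (k rH)\<^sup>2 / z ^ 4 \<le> 6 * (k rH)\<^sup>2 / rH ^ 4"
        using z rH_pos by (intro divide_left_mono power_mono) auto
      ultimately show "(3 * H\<^sup>2 * z\<^sup>2 + 6 * (k rH)\<^sup>2 / z ^ 4) - L \<le> 0"
        by (simp add: L_def power_mult_distrib)
    qed
    then show ?thesis using m_k[of rH] nu_rH rH_pos rH_less by simp
  qed
  define q where "q = L / rH\<^sup>2"
  have "Q (k rH) x - q * (x - rH)\<^sup>2 \<le> Q (k rH) rH - q * (rH - rH)\<^sup>2"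
  proof (rule DERIV_nonpos_imp_nonincreasing[OF x(1)], intro exI conjI)
    fix z assume "rH \<le> z" "z \<le> x"
    then have z: "0 < z" "rH \<le> z" "z < 2 * M" using x rH_pos by auto
    show "((\<lambda>x. Q (k rH) x - q * (x - rH)\<^sup>2) has_real_derivative
        2 * m (k rH) z / z\<^sup>2 - q * (2 * (z - rH))) (at z)"
      by (auto intro!: derivative_eq_intros Q_deriv z)
    have "0 \<le> L" by (simp add: L_def)
    then have "2 * m (k rH) z / z\<^sup>2 \<le> 2 * (L * (z - rH)) / rH\<^sup>2"
      using z rH_pos m_le[of z] by (intro frac_le power_mono) auto
    then show "2 * m (k rH) z / z\<^sup>2 - q * (2 * (z - rH)) \<le> 0"
      by (simp add: q_def mult_ac)
  qed
  then show ?thesis using Q_k[of rH] rH_pos rH_less by (simp add: L_def q_def)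
qed

section \<open>The integrand and its integral from the throat\<close>

lemma continuous_on_f:
  assumes "\<And>x. x \<in> S \<Longrightarrow> 0 < x \<and> x < 2 * M \<and> c < k x"
  shows "continuous_on S (f c)"
proof -
  have "0 < Q c x" if "x \<in> S" for x using Q_pos assms that by auto
  then show ?thesis
    unfolding f_def [abs_def] Q_def a_def
    by (intro continuous_intros) (use assms in force)+
qed

lemma f_pos:
  assumes "0 < x" "x < 2 * M" "c < k x"
  shows "0 < f c x"
  using assms Q_pos[of x c] g_pos[of x] a_eq[of c x] by (simp add: f_def)

lemma f_strict_mono:
  assumes "0 < x" "x < 2 * M" "c1 < c2" "c2 < k x"
  shows "f c1 x < f c2 x"
  unfolding f_eq[OF assms(1,2)]
  using assms g_pos[of x] by (intro mult_strict_left_mono ratio_strict_antimono) (auto simp: a_eq)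

text \<open>Raising \<open>c\<close> lowers \<open>a c x\<close>, so \<open>c2\<close> is the steep
  end in \<open>ratio_tangent\<close>; the last factor is the \<open>c\<close>-derivative of
  \<open>f\<close> there.\<close>

lemma f_tangent:
  assumes "0 < x" "x < 2 * M" "c1 \<le> c2" "c2 < k x"
  shows "f c2 x - f c1 x \<le> (c2 - c1) * (1 / (x\<^sup>2 * sqrt (Q c2 x) ^ 3))"
proof -
  let ?s = "\<lambda>c. sqrt ((a c x)\<^sup>2 - (g x)\<^sup>2)"
  let ?w = "x / (2 * M - x)"
  have "a c2 x / ?s c2 - a c1 x / ?s c1 \<le> (a c1 x - a c2 x) * ((g x)\<^sup>2 / ?s c2 ^ 3)"
    using assms g_pos[of x] by (intro ratio_tangent) (auto simp: a_eq)
  then have "?w * (a c2 x / ?s c2 - a c1 x / ?s c1) \<le> ?w * ((a c1 x - a c2 x) * ((g x)\<^sup>2 / ?s c2 ^ 3))"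
    using assms by (intro mult_left_mono) auto
  also have "?w * ((a c1 x - a c2 x) * ((g x)\<^sup>2 / ?s c2 ^ 3)) = (c2 - c1) * (x ^ 4 / ?s c2 ^ 3)"
    using assms by (simp add: a_def g_sq power3_eq_cube power4_eq_xxxx)
  also have "x ^ 4 / ?s c2 ^ 3 = 1 / (x\<^sup>2 * sqrt (Q c2 x) ^ 3)"
  proof -
    have "sqrt (x ^ 4) = x\<^sup>2" by (rule real_sqrt_unique) auto
    then have "?s c2 = x\<^sup>2 * sqrt (Q c2 x)" using assms by (simp add: Q_factor real_sqrt_divide)
    then show ?thesis using assms by (simp add: power_mult_distrib divide_simps)
  qed
  finally show ?thesis unfolding f_eq[OF assms(1,2)] by (simp add: right_diff_distrib)
qed

text \<open>One \<open>K\<close> serves all throats in \<open>{s..r}\<close>, because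
  \<open>nu\<close> has a positive minimum there; the bound degenerates at \<open>rH\<close>, where
  \<open>nu\<close> vanishes.\<close>

lemma f_singularity_bound:
  assumes "rH < s" "s \<le> r" "r < 2 * M"
  obtains K where "0 \<le> K" "\<And>\<rho> x. s \<le> \<rho> \<Longrightarrow> \<rho> < x \<Longrightarrow> x \<le> r \<Longrightarrow> f (k \<rho>) x \<le> K / sqrt (x - \<rho>)"
proof -
  obtain z where z: "s \<le> z" "z \<le> r" "\<And>\<rho>. s \<le> \<rho> \<Longrightarrow> \<rho> \<le> r \<Longrightarrow> nu z \<le> nu \<rho>"
    using continuous_attains_inf[of "{s..r}" nu] assms continuous_on_nu by auto
  define n where "n = nu z / (2 * M\<^sup>2)"
  have n: "0 < n" using nu_pos[of z] z assms M_pos by (simp add: n_def)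
  \<comment> \<open>\<open>k\<close> is increasing on this range, so
    \<open>a (k \<rho>) x \<le> a (k s) x\<close>; \<open>B\<close> bounds the latter up to the
    horizon.\<close>
  define B where "B = \<bar>k s\<bar> + \<bar>H\<bar> * (2 * M) ^ 3"
  have "0 < s" using assms rH_pos by simp
  define K where "K = B / (s * (2 * M - r) * sqrt n)"
  show thesis
  proof (rule that[of K])
    show "0 \<le> K" using \<open>0 < s\<close> assms n M_pos by (simp add: K_def B_def)
    fix \<rho> x assume x: "s \<le> \<rho>" "\<rho> < x" "x \<le> r"
    have "a (k \<rho>) x \<le> a (k s) x"
      using k_mono[of s \<rho>] x assms by (simp add: a_def)
    also have "\<dots> \<le> B"
    proof -
      have "x ^ 3 \<le> (2 * M) ^ 3" using x \<open>0 < s\<close> assms by (intro power_mono) auto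
      then have "\<bar>H * x ^ 3\<bar> \<le> \<bar>H\<bar> * (2 * M) ^ 3"
        unfolding abs_mult using x \<open>0 < s\<close> by (intro mult_left_mono) auto
      then show ?thesis unfolding a_def B_def by linarith
    qed
    finally have aB: "a (k \<rho>) x \<le> B" .
    have "n * (x - \<rho>) \<le> nu \<rho> / (2 * M\<^sup>2) * (x - \<rho>)"
      using z(3)[of \<rho>] x unfolding n_def by (intro mult_right_mono divide_right_mono) auto
    also have "\<dots> \<le> Q (k \<rho>) x" using Q_lower[of \<rho> x] x assms by auto
    finally have "sqrt n * sqrt (x - \<rho>) \<le> sqrt (Q (k \<rho>) x)"
      by (simp flip: real_sqrt_mult)
    then have "f (k \<rho>) x \<le> B / (s * (2 * M - r) * (sqrt n * sqrt (x - \<rho>)))"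
      unfolding f_def using aB x assms n \<open>0 < s\<close> M_pos
      by (intro frac_le mult_mono mult_pos_pos) (auto simp: B_def)
    then show "f (k \<rho>) x \<le> K / sqrt (x - \<rho>)" by (simp add: K_def mult_ac)
  qed
qed

lemma k_less: "rH \<le> \<rho> \<Longrightarrow> \<rho> < x \<Longrightarrow> x < 2 * M \<Longrightarrow> 0 < x \<and> x < 2 * M \<and> k \<rho> < k x"
  using k_strict_mono[of \<rho> x] rH_pos by simp

text \<open>\<open>K\<close> is fixed before \<open>\<rho>\<close> and \<open>x\<close>. This
  uniformity gives the continuity of \<open>F\<close> in the throat radius, and the square root
  makes short pieces next to a throat negligible.\<close>

lemma F_facts:
  assumes "rH < s" "r < 2 * M"
  obtains K where "0 \<le> K" "\<And>\<rho> x. s \<le> \<rho> \<Longrightarrow> \<rho> \<le> x \<Longrightarrow> x \<le> r \<Longrightarrow> 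
     f (k \<rho>) integrable_on {\<rho>..x} \<and> 0 \<le> F \<rho> x \<and> F \<rho> x \<le> K * sqrt (x - \<rho>)"
proof (cases "s \<le> r")
  case True
  obtain K where K: "0 \<le> K" "\<And>\<rho> x. s \<le> \<rho> \<Longrightarrow> \<rho> < x \<Longrightarrow> x \<le> r \<Longrightarrow> f (k \<rho>) x \<le> K / sqrt (x - \<rho>)"
    using f_singularity_bound[OF assms(1) True assms(2)] by blast
  show thesis
  proof (rule that[of "2 * K"])
    fix \<rho> x assume x: "s \<le> \<rho>" "\<rho> \<le> x" "x \<le> r"
    have dom: "0 < y \<and> y < 2 * M \<and> k \<rho> < k y" if "y \<in> {\<rho><..x}" for y
      using k_less[of \<rho> y] that x assms by auto
    have "0 \<le> f (k \<rho>) y \<and> f (k \<rho>) y \<le> K / sqrt (y - \<rho>)" if "y \<in> {\<rho><..x}" for y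
      using dom[OF that] f_pos[of y "k \<rho>"] K(2)[of \<rho> y] that x by auto
    from integrable_inverse_sqrt_singularity[OF x(2) continuous_on_f[OF dom] this]
    show "f (k \<rho>) integrable_on {\<rho>..x} \<and> 0 \<le> F \<rho> x \<and> F \<rho> x \<le> 2 * K * sqrt (x - \<rho>)"
      by (auto simp: F_def)
  qed (use K in auto)
qed (auto intro: that[of 0])

lemma f_integrable:
  assumes "rH < \<rho>" "\<rho> \<le> r" "r < 2 * M"
  shows "f (k \<rho>) integrable_on {\<rho>..r}"
  by (rule F_facts[OF assms(1,3)]) (use assms in auto)

lemma f_integrable_right:
  assumes "k rH \<le> c" "c < k x" "rH \<le> x" "y < 2 * M"
  shows "f c integrable_on {x..y}"
  by (intro integrable_continuous_interval continuous_on_f)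
     (use assms rH_pos k_mono[of x] in force)

lemma F_split:
  assumes "rH < \<rho>" "\<rho> \<le> x" "x \<le> r" "r < 2 * M"
  shows "F \<rho> r = F \<rho> x + integral {x..r} (f (k \<rho>))"
  unfolding F_def using f_integrable[of \<rho> r] assms by (simp add: Henstock_Kurzweil_Integration.integral_combine)

lemma F_self: "F \<rho> \<rho> = 0"
  by (simp add: F_def)

subsection \<open>Monotonicity in the throat radius\<close>

text \<open>The tangent bound in \<open>c\<close> is compared with \<open>E'\<close> and integrated.
  The right-hand side is \<open>(c2 - c1) * (- E u)\<close>, the boundary term that later cancels
  against the motion of the left endpoint.\<close>

lemma integral_f_increment:
  assumes c: "k rH \<le> c1" "k rH < c2" "c1 \<le> c2" "c2 < k u" and u: "rH < u" "u \<le> r" "r < 2 * M"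
  shows "integral {u..r} (f c2) - integral {u..r} (f c1) \<le> (c2 - c1) / (m c2 u * sqrt (Q c2 u))"
proof -
  define s where "s x = sqrt (Q c2 x)" for x
  define E where "E x = - (1 / (m c2 x * s x))" for x
  define m' where "m' x = 3 * H\<^sup>2 * x\<^sup>2 + 6 * c2\<^sup>2 / x ^ 4" for x
  define E' where "E' x = (m' x * s x + m c2 x * (2 * m c2 x / x\<^sup>2 * (inverse (s x) / 2))) / (m c2 x * s x)\<^sup>2" for x
  have x: "0 < x" "x < 2 * M" "c2 < k x" "0 < m c2 x" "0 < Q c2 x" "0 < s x" "(s x)\<^sup>2 = Q c2 x"
    if "x \<in> {u..r}" for x
  proof -
    show 1: "0 < x" "x < 2 * M" "c2 < k x"
      using that u rH_pos c k_mono[of u x] by auto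
    show "0 < m c2 x" using 1 that u c by (intro m_pos) auto
    show "0 < Q c2 x" by (intro Q_pos 1)
    then show "0 < s x" "(s x)\<^sup>2 = Q c2 x" by (auto simp: s_def)
  qed
  have E_deriv: "(E has_real_derivative E' x) (at x)" if "x \<in> {u..r}" for x
  proof -
    note X = x[OF that]
    have s: "(s has_real_derivative 2 * m c2 x / x\<^sup>2 * (inverse (s x) / 2)) (at x)"
      using DERIV_chain2[OF DERIV_real_sqrt[OF X(5)] Q_deriv[OF X(1)]]
      by (simp add: s_def [abs_def] mult.commute)
    show ?thesis
      unfolding E_def [abs_def] E'_def m'_def using X
      by (auto intro!: derivative_eq_intros s m_deriv
          simp: power2_eq_square add_divide_distrib diff_divide_distrib mult_ac)
  qed
  \<comment> \<open>The derivative of \<open>s\<close> is \<open>m / (x\<^sup>2 * s)\<close>, so the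
    second summand of \<open>E'\<close> is exactly \<open>1 / (x\<^sup>2 * s ^ 3)\<close>; the first
    is nonnegative because \<open>m'\<close> is.\<close>
  have E'_ge: "1 / (x\<^sup>2 * s x ^ 3) \<le> E' x" if "x \<in> {u..r}" for x
  proof -
    note X = x[OF that]
    have "E' x = m' x * s x / (m c2 x * s x)\<^sup>2 + 1 / (x\<^sup>2 * s x ^ 3)"
      unfolding E'_def using X(1,4,6) by (simp add: divide_simps) algebra
    moreover have "0 \<le> m' x * s x / (m c2 x * s x)\<^sup>2"
      using X by (simp add: m'_def)
    ultimately show ?thesis by simp
  qed
  have "(E' has_integral E r - E u) {u..r}"
    using u(2) by (rule fundamental_theorem_of_calculus)
      (use E_deriv has_real_derivative_iff_has_vector_derivative has_vector_derivative_at_within in blast)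
  then have int: "((\<lambda>x. (c2 - c1) * E' x) has_integral (c2 - c1) * (E r - E u)) {u..r}"
    by (rule has_integral_mult_right)
  have f_int: "f c1 integrable_on {u..r}" "f c2 integrable_on {u..r}"
    using c u by (auto intro!: f_integrable_right)
  have "integral {u..r} (f c2) - integral {u..r} (f c1) = integral {u..r} (\<lambda>x. f c2 x - f c1 x)"
    using f_int by (simp add: integral_diff)
  also have "\<dots> \<le> (c2 - c1) * (E r - E u)"
  proof (rule has_integral_le[OF integrable_integral int])
    show "(\<lambda>x. f c2 x - f c1 x) integrable_on {u..r}" using f_int by (intro integrable_diff)
    fix y assume y: "y \<in> {u..r}"
    have "f c2 y - f c1 y \<le> (c2 - c1) * (1 / (y\<^sup>2 * s y ^ 3))"
      unfolding s_def using x[OF y] c by (intro f_tangent) auto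
    also have "\<dots> \<le> (c2 - c1) * E' y" using E'_ge[OF y] c by (intro mult_left_mono) auto
    finally show "f c2 y - f c1 y \<le> (c2 - c1) * E' y" .
  qed
  \<comment> \<open>The outer boundary term \<open>E r\<close> has a favourable sign and is
    dropped.\<close>
  also have "\<dots> \<le> (c2 - c1) * (- E u)"
  proof (rule mult_left_mono)
    have "E r \<le> 0" using x[of r] u by (simp add: E_def)
    then show "E r - E u \<le> - E u" by simp
  qed (use c in auto)
  finally show ?thesis by (simp add: E_def s_def)
qed

text \<open>The \<open>c\<close> whose slice attains \<open>Q = e\<close> at radius
  \<open>x\<close>, on the branch \<open>a \<ge> 0\<close>; in particular
  \<open>b 0 = k\<close>.\<close>

definition b :: "real \<Rightarrow> real \<Rightarrow> real" where
  "b e x = - H * x ^ 3 - sqrt (e * x ^ 4 + x ^ 3 * (2 * M - x))"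

lemma a_b: "a (b e x) x = sqrt (e * x ^ 4 + x ^ 3 * (2 * M - x))"
  by (simp add: a_def b_def)

lemma Q_b:
  assumes "0 < x" "x < 2 * M" "0 \<le> e"
  shows "Q (b e x) x = e"
proof -
  have "(a (b e x) x)\<^sup>2 = e * x ^ 4 + x ^ 3 * (2 * M - x)"
    using assms by (simp add: a_b)
  then show ?thesis using assms by (simp add: Q_factor g_sq)
qed

lemma a_pos_unique:
  assumes "0 < x" "Q c x = Q d x" "0 \<le> a c x" "0 \<le> a d x"
  shows "c = d"
proof -
  have "(a c x)\<^sup>2 = (a d x)\<^sup>2" using assms(1,2) by (simp add: Q_def power_divide)
  then have "a c x = a d x" using assms power2_eq_iff_nonneg by blast
  then show ?thesis by (simp add: a_def)
qed

lemma Q_mono: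
  assumes "0 < x" "c \<le> d" "0 \<le> a d x"
  shows "Q d x \<le> Q c x"
proof -
  have "(a d x)\<^sup>2 \<le> (a c x)\<^sup>2" using assms by (intro power_mono) (auto simp: a_def)
  then show ?thesis using assms by (simp add: Q_def power_divide divide_right_mono)
qed

text \<open>The formula is what implicit differentiation of \<open>Q (b e x) x = e\<close> gives:
  \<open>Q\<close> has \<open>x\<close>-derivative \<open>2 * m / x\<^sup>2\<close> and
  \<open>c\<close>-derivative \<open>- 2 * a / x ^ 4\<close>.\<close>

lemma b_deriv:
  assumes "0 < x" "x < 2 * M" "0 \<le> e"
  shows "(b e has_real_derivative x\<^sup>2 * m (b e x) x / a (b e x) x) (at x)"
proof -
  have p: "0 < e * x ^ 4 + x ^ 3 * (2 * M - x)"
    using assms by (intro add_nonneg_pos) auto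
  define A where "A = a (b e x) x"
  have A: "0 < A" "A\<^sup>2 = e * x ^ 4 + x ^ 3 * (2 * M - x)" using p by (auto simp: A_def a_b)
  have A_eq: "A = sqrt (e * x ^ 4 + x ^ 3 * (2 * M - x))" by (simp add: A_def a_b)
  have "(b e has_real_derivative - H * (3 * x\<^sup>2)
      - (e * (4 * x ^ 3) + (3 * x\<^sup>2 * (2 * M - x) - x ^ 3)) * (inverse A / 2)) (at x)"
    unfolding b_def [abs_def] A_eq
    by (rule derivative_eq_intros refl | use p in \<open>force simp: power2_eq_square power3_eq_cube\<close>)+
  moreover have "- H * (3 * x\<^sup>2)
      - (e * (4 * x ^ 3) + (3 * x\<^sup>2 * (2 * M - x) - x ^ 3)) * (inverse A / 2) = x\<^sup>2 * m (b e x) x / A"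
  proof -
    have "m (b e x) x = M - 3 * H * A - 2 * A\<^sup>2 / x ^ 3"
    proof -
      have "b e x = - H * x ^ 3 - A" by (simp add: A_def a_def)
      then show ?thesis using assms(1) unfolding m_def A_def[symmetric]
        by (simp add: divide_simps) (simp add: power2_eq_square algebra_simps)
    qed
    also have "\<dots> = M - 3 * H * A - 2 * (e * x + (2 * M - x))"
      unfolding A(2) using assms(1) by (simp add: divide_simps) algebra
    finally show ?thesis using A(1)
      by (simp add: divide_simps) (simp add: power2_eq_square power3_eq_cube algebra_simps)
  qed
  ultimately show ?thesis by (simp add: A_def)
qed

text \<open>Cutting the slices off at \<open>Q = e\<close> rather than at the throat \<open>Q = 0\<close> makes all
  integrals proper. The local estimate reduces to \<open>x\<^sup>2 / (a * sqrt e) < f\<close> along the cut-off, where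
  the difference of the two sides is \<open>x ^ 3 * sqrt e / ((2 * M - x) * a)\<close>.\<close>

lemma truncated_decreasing:
  assumes e: "0 < e" and t: "rH < t1" "t1 \<le> t2" "t2 \<le> r" "r < 2 * M"
    and b_range: "\<And>x. x \<in> {t1..t2} \<Longrightarrow> k rH < b e x"
  shows "integral {t2..r} (f (b e t2)) \<le> integral {t1..r} (f (b e t1))"
proof -
  have dom: "0 < x" "x < 2 * M" "rH < x" "k rH < b e x" "b e x < k x" "0 < a (b e x) x"
    "Q (b e x) x = e" "0 < m (b e x) x" if "x \<in> {t1..t2}" for x
  proof -
    show 1: "0 < x" "x < 2 * M" "rH < x" "k rH < b e x" using that t b_range rH_pos by auto
    show 2: "b e x < k x" using 1 e by (simp add: b_def k_def g_def)
    have "0 < e * x ^ 4 + x ^ 3 * (2 * M - x)"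
      using 1 e by (intro add_pos_pos) auto
    then show "0 < a (b e x) x" by (simp add: a_b)
    show "Q (b e x) x = e" using 1 e by (intro Q_b) auto
    show "0 < m (b e x) x" using 1 2 by (intro m_pos) auto
  qed
  have b_mono: "b e x \<le> b e y" if "t1 \<le> x" "x \<le> y" "y \<le> t2" for x y
  proof (rule DERIV_nonneg_imp_nondecreasing[OF that(2)], intro exI conjI)
    fix z assume "x \<le> z" "z \<le> y"
    then have z: "z \<in> {t1..t2}" using that by auto
    show "(b e has_real_derivative z\<^sup>2 * m (b e z) z / a (b e z) z) (at z)"
      using dom[OF z] e by (intro b_deriv) auto
    show "0 \<le> z\<^sup>2 * m (b e z) z / a (b e z) z" using dom[OF z] by simp
  qed
  \<comment> \<open>The inequality is transitive in the cut-off, so bisection reduces it to short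
    intervals around each point.\<close>
  define P where "P u v \<longleftrightarrow> (t1 \<le> u \<and> u \<le> v \<and> v \<le> t2 \<longrightarrow>
    integral {v..r} (f (b e v)) \<le> integral {u..r} (f (b e u)))" for u v
  have "P t1 t2" using t(2)
  proof (induction rule: Bolzano)
    case (trans u v w)
    then show ?case unfolding P_def by linarith
  next
    case (local z)
    then have z: "z \<in> {t1..t2}" by simp
    note Z = dom[OF z]
    \<comment> \<open>On the diagonal, \<open>\<phi>\<close> is
      \<open>x\<^sup>2 / (a * sqrt e)\<close> and \<open>\<psi>\<close> is \<open>f\<close> along
      the cut-off. Two arguments are kept because the mean value theorem evaluates the derivative of
      \<open>b\<close> at some \<open>\<xi>\<close> while the boundary term sits at
      \<open>v\<close>, and because \<open>\<psi>\<close> must let the radius vary on the fixed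
      slice cut at \<open>u\<close>.\<close>
    define \<phi> where "\<phi> p = (fst p)\<^sup>2 * m (b e (fst p)) (fst p) / a (b e (fst p)) (fst p)
      / (m (b e (snd p)) (snd p) * sqrt e)" for p :: "real \<times> real"
    define \<psi> where "\<psi> p = f (b e (fst p)) (snd p)" for p :: "real \<times> real"
    have \<phi>_cont: "isCont \<phi> (z, z)"
    proof -
      have "a (b e z) z \<noteq> 0" "m (b e z) z \<noteq> 0" using Z by auto
      then show ?thesis
        unfolding \<phi>_def [abs_def] m_def a_def b_def
        by (intro continuous_intros) (use Z e in auto)
    qed
    have \<psi>_cont: "isCont \<psi> (z, z)"
    proof -
      have "Q (b e z) z \<noteq> 0" using Z e by auto
      then show ?thesis
        unfolding \<psi>_def [abs_def] f_def Q_def a_def b_def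
        by (intro continuous_intros) (use Z e in auto)
    qed
    have "\<phi> (z, z) < \<psi> (z, z)"
    proof -
      define A S where "A = a (b e z) z" and "S = sqrt e"
      have AS: "0 < A" "0 < S" "S\<^sup>2 = e" using Z e by (auto simp: A_def S_def)
      have "A\<^sup>2 = S\<^sup>2 * z ^ 4 + z ^ 3 * (2 * M - z)" using AS(3) a_b[of e z] Z e by (simp add: A_def)
      then have "\<psi> (z, z) = z\<^sup>2 / (A * S) + z ^ 3 * S / ((2 * M - z) * A)"
        unfolding \<psi>_def f_def Z(7) fst_conv snd_conv A_def[symmetric] S_def[symmetric]
        using AS(1,2) Z(1,2) by (simp add: divide_simps) algebra
      moreover have "\<phi> (z, z) = z\<^sup>2 / (A * S)"
        unfolding \<phi>_def fst_conv snd_conv A_def[symmetric] S_def[symmetric]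
        using Z by simp
      ultimately show ?thesis using AS Z by simp
    qed
    then obtain L where L: "\<phi> (z, z) < L" "L < \<psi> (z, z)" using dense by blast
    have "eventually (\<lambda>p. \<phi> p < L \<and> L < \<psi> p) (nhds (z, z))"
      using \<phi>_cont \<psi>_cont unfolding isCont_def tendsto_at_iff_tendsto_nhds
      by (intro eventually_conj order_tendstoD(2)[OF _ L(1)] order_tendstoD(1)[OF _ L(2)])
    then obtain d where d: "0 < d" "\<And>p. dist p (z, z) < d \<Longrightarrow> \<phi> p < L \<and> L < \<psi> p"
      unfolding eventually_nhds_metric by blast
    show ?case
    proof (intro exI[of _ "d / 2"] conjI allI impI)
      fix u v assume uv: "u \<le> z \<and> z \<le> v \<and> v - u < d / 2"
      have near: "\<phi> (x, y) < L" "L < \<psi> (x, y)" if "x \<in> {u..v}" "y \<in> {u..v}" for x y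
      proof -
        have "dist (x, y) (z, z) \<le> dist x z + dist y z"
          unfolding dist_Pair_Pair using sqrt_sum_squares_le_sum_abs[of "dist x z" "dist y z"] by simp
        also have "\<dots> < d" using that uv by (auto simp: dist_real_def)
        finally show "\<phi> (x, y) < L" "L < \<psi> (x, y)" using d(2) by auto
      qed
      show "P u v" unfolding P_def
      proof (intro impI, cases "u = v")
        case False
        assume "t1 \<le> u \<and> u \<le> v \<and> v \<le> t2"
        with False have u: "t1 \<le> u" "u < v" "v \<le> t2" by auto
        have U: "u \<in> {t1..t2}" and V: "v \<in> {t1..t2}" using u by auto
        note U' = dom[OF U] and V' = dom[OF V]
        have vr: "v \<le> r" using u t by simp
        obtain \<xi> where \<xi>: "u < \<xi>" "\<xi> < v"
          "b e v - b e u = (v - u) * (\<xi>\<^sup>2 * m (b e \<xi>) \<xi> / a (b e \<xi>) \<xi>)"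
        proof -
          have "\<exists>\<xi>>u. \<xi> < v \<and> b e v - b e u = (v - u) * (\<xi>\<^sup>2 * m (b e \<xi>) \<xi> / a (b e \<xi>) \<xi>)"
            by (rule MVT2[OF u(2)], rule b_deriv) (use u dom e in auto)
          then show thesis using that by blast
        qed
        \<comment> \<open>On the common range \<open>{v..r}\<close> the slice cut at
          \<open>v\<close> gains at most \<open>(v - u) * L\<close>, and the slice cut at
          \<open>u\<close> collects at least this much on \<open>{u..v}\<close>.\<close>
        have "integral {v..r} (f (b e v)) - integral {v..r} (f (b e u))
            \<le> (b e v - b e u) / (m (b e v) v * sqrt (Q (b e v) v))"
          using b_mono[of u v] u U' V' vr t by (intro integral_f_increment) auto
        also have "\<dots> = (v - u) * \<phi> (\<xi>, v)"
          unfolding \<xi>(3) V'(7) by (simp add: \<phi>_def)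
        also have "\<dots> \<le> (v - u) * L"
          using near(1)[of \<xi> v] \<xi> u by (intro mult_left_mono) auto
        also have "\<dots> = integral {u..v} (\<lambda>x. L)" using u by simp
        also have "\<dots> \<le> integral {u..v} (f (b e u))"
          using near(2)[of u] u U' V' by (intro integral_le f_integrable_right)
            (auto simp: \<psi>_def intro: less_imp_le)
        also have "integral {u..v} (f (b e u)) = integral {u..r} (f (b e u)) - integral {v..r} (f (b e u))"
        proof -
          have "f (b e u) integrable_on {u..r}" using U' t by (intro f_integrable_right) auto
          from Henstock_Kurzweil_Integration.integral_combine[OF _ vr this] u show ?thesis by simp
        qed
        finally show "integral {v..r} (f (b e v)) \<le> integral {u..r} (f (b e u))" by simp
      qed auto
    qed (use d in auto)
  qed
  then show ?thesis using t by (simp add: P_def)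
qed

text \<open>The slice of \<open>\<rho>2\<close> is cut at \<open>t > \<rho>2\<close>, and that of
  \<open>\<rho>1\<close> at the radius \<open>t1\<close> where \<open>Q\<close> has the same value
  \<open>e\<close>. Both parameters are then values of \<open>b e\<close>, so
  \<open>truncated_decreasing\<close> compares the integrals; finally \<open>t\<close> tends to
  \<open>\<rho>2\<close>.\<close>

lemma F_antimono:
  assumes "rH < \<rho>1" "\<rho>1 < \<rho>2" "\<rho>2 < r" "r < 2 * M"
  shows "F \<rho>2 r \<le> F \<rho>1 r"
proof -
  have k12: "k rH < k \<rho>1" "k \<rho>1 < k \<rho>2"
    using assms by (auto intro!: k_strict_mono)
  have cut: "integral {t..r} (f (k \<rho>2)) \<le> F \<rho>1 r" if t: "\<rho>2 < t" "t < r" for t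
  proof -
    define e where "e = Q (k \<rho>2) t"
    have t': "0 < t" "t < 2 * M" "k \<rho>2 < k t" "0 < g t"
      using t assms rH_pos k_strict_mono[of \<rho>2 t] g_pos[of t] by auto
    have a2: "0 < a (k \<rho>2) t" using t' by (simp add: a_eq)
    have e: "0 < e" unfolding e_def by (intro Q_pos t')
    have bt: "b e t = k \<rho>2"
    proof (rule a_pos_unique[OF t'(1)])
      show "Q (b e t) t = Q (k \<rho>2) t" using Q_b[of t e] t' e by (simp add: e_def)
    qed (use a2 e t' in \<open>auto simp: a_b intro!: add_nonneg_nonneg\<close>)
    have Q_inc: "Q (k \<rho>1) x \<le> Q (k \<rho>1) y" if "\<rho>1 \<le> x" "x \<le> y" "y < 2 * M" for x y
    proof (rule DERIV_nonneg_imp_nondecreasing[OF that(2)], intro exI conjI)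
      fix z assume z: "x \<le> z" "z \<le> y"
      show "(Q (k \<rho>1) has_real_derivative 2 * m (k \<rho>1) z / z\<^sup>2) (at z)"
        using z that assms rH_pos by (intro Q_deriv) auto
      show "0 \<le> 2 * m (k \<rho>1) z / z\<^sup>2"
        using m_ge_nu[of \<rho>1 z] nu_pos[of \<rho>1] z that assms by auto
    qed
    \<comment> \<open>\<open>Q (k \<rho>1)\<close> climbs from \<open>0\<close> at its throat to at
      least \<open>e\<close> at \<open>t\<close>, because a smaller \<open>c\<close> makes
      \<open>Q\<close> larger.\<close>
    obtain t1 where t1: "\<rho>1 \<le> t1" "t1 \<le> t" "Q (k \<rho>1) t1 = e"
    proof -
      have "Q (k \<rho>1) \<rho>1 \<le> e" using Q_k[of \<rho>1] assms rH_pos e by simp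
      moreover have "e \<le> Q (k \<rho>1) t"
        unfolding e_def using k12 a2 t' by (intro Q_mono) auto
      moreover have "continuous_on {\<rho>1..t} (Q (k \<rho>1))"
        unfolding Q_def [abs_def] a_def
        by (intro continuous_intros) (use assms rH_pos in auto)
      ultimately show thesis using IVT'[of "Q (k \<rho>1)" \<rho>1 e t] that assms t by auto
    qed
    have "t1 \<noteq> \<rho>1" using t1(3) e Q_k[of \<rho>1] assms rH_pos by auto
    then have t1': "\<rho>1 < t1" using t1 by simp
    \<comment> \<open>Were \<open>b e x\<close> below \<open>k \<rho>1\<close>, then
      \<open>Q (k \<rho>1) x < e\<close>, although this function has reached \<open>e\<close> at
      \<open>t1\<close> and does not decrease afterwards. The bound keeps \<open>b e\<close> above
      \<open>k rH\<close>.\<close>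
    have b_ge: "k \<rho>1 \<le> b e x" if x: "x \<in> {t1..t}" for x
    proof (rule ccontr)
      assume neg: "\<not> k \<rho>1 \<le> b e x"
      have x': "0 < x" "x < 2 * M" "\<rho>1 < x" using x t1' t' assms rH_pos by auto
      have "0 < a (k \<rho>1) x" using k_strict_mono[of \<rho>1 x] g_pos[of x] x' assms by (simp add: a_eq)
      then have "(a (k \<rho>1) x)\<^sup>2 < (a (b e x) x)\<^sup>2"
        using neg by (intro power_strict_mono) (auto simp: a_def)
      then have "Q (k \<rho>1) x < Q (b e x) x"
        using x' by (simp add: Q_def power_divide divide_strict_right_mono)
      also have "\<dots> = e" using x' e by (intro Q_b) auto
      also have "e \<le> Q (k \<rho>1) x" using Q_inc[of t1 x] t1 t1' x x' by auto
      finally show False by simp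
    qed
    have bt1: "b e t1 = k \<rho>1"
    proof (rule a_pos_unique)
      have "t1 < 2 * M" using t1 t' by simp
      then show "Q (b e t1) t1 = Q (k \<rho>1) t1" "0 < t1" "0 \<le> a (b e t1) t1"
        using Q_b[of t1 e] t1 t1' assms rH_pos e by (auto simp: a_b)
      show "0 \<le> a (k \<rho>1) t1"
        using k_strict_mono[of \<rho>1 t1] g_pos[of t1] t1' \<open>t1 < 2 * M\<close> assms rH_pos by (simp add: a_eq)
    qed
    have "integral {t..r} (f (b e t)) \<le> integral {t1..r} (f (b e t1))"
    proof (rule truncated_decreasing[OF e])
      show "k rH < b e x" if "x \<in> {t1..t}" for x using b_ge[OF that] k12 by simp
    qed (use t1 t1' t assms in auto)
    also have "\<dots> = F \<rho>1 r - F \<rho>1 t1"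
      unfolding bt1 using F_split[of \<rho>1 t1 r] t1' t1 t assms by auto
    also have "\<dots> \<le> F \<rho>1 r"
      using F_facts[of \<rho>1 t1] t1' t1 t' assms by (metis diff_le_eq le_add_same_cancel1 less_eq_real_def order.strict_trans1)
    finally show ?thesis unfolding bt .
  qed
  obtain K where K: "\<And>x. \<rho>2 \<le> x \<Longrightarrow> x \<le> r \<Longrightarrow> F \<rho>2 x \<le> K * sqrt (x - \<rho>2)"
    using F_facts[of \<rho>2 r] assms by (metis order.refl order.strict_trans)
  \<comment> \<open>The piece \<open>F \<rho>2 t\<close> that was cut away is at most
    \<open>K * sqrt (t - \<rho>2)\<close> and disappears in the limit.\<close>
  have bound: "\<forall>\<^sub>F t in at_right \<rho>2. F \<rho>2 r \<le> K * sqrt (t - \<rho>2) + F \<rho>1 r"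
    using eventually_at_right_real[OF assms(3)]
  proof eventually_elim
    case (elim t)
    have "F \<rho>2 r = F \<rho>2 t + integral {t..r} (f (k \<rho>2))"
      using elim assms by (intro F_split) auto
    then show ?case using K[of t] cut[of t] elim by auto
  qed
  have "((\<lambda>t. K * sqrt (t - \<rho>2) + F \<rho>1 r) \<longlongrightarrow> K * sqrt (\<rho>2 - \<rho>2) + F \<rho>1 r) (at_right \<rho>2)"
    by (intro tendsto_intros)
  from tendsto_lowerbound[OF this bound] show ?thesis by simp
qed

lemma F_pos:
  assumes "rH < \<rho>" "\<rho> < r" "r < 2 * M"
  shows "0 < F \<rho> r"
proof -
  define x where "x = (\<rho> + r) / 2"
  have x: "\<rho> < x" "x < r" using assms by (auto simp: x_def)
  have dom: "0 < y \<and> y < 2 * M \<and> k \<rho> < k y" if "y \<in> {x..r}" for y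
    using k_less[of \<rho> y] that x assms by auto
  have "integral {x..r} (\<lambda>y. 0) < integral {x..r} (f (k \<rho>))"
    using x by (intro integral_strict_mono continuous_on_f continuous_on_const)
      (use dom f_pos in auto)
  moreover have "0 \<le> F \<rho> x"
    by (rule F_facts[of \<rho> r]) (use x assms in auto)
  ultimately show ?thesis using F_split[of \<rho> x r] x assms by auto
qed

text \<open>Strictness comes from a larger radius \<open>R\<close>: the weak inequality holds there,
  while on \<open>{r..R}\<close> the slice with the larger \<open>c\<close> climbs strictly faster,
  so it is strictly lower at \<open>r\<close>.\<close>

lemma F_strict_antimono:
  assumes "rH < \<rho>1" "\<rho>1 < \<rho>2" "\<rho>2 \<le> r" "r < 2 * M"
  shows "F \<rho>2 r < F \<rho>1 r"
proof (cases "\<rho>2 = r")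
  case True
  then show ?thesis using F_pos[of \<rho>1 r] F_self assms by auto
next
  case False
  define R where "R = (r + 2 * M) / 2"
  have R: "\<rho>2 < r" "r < R" "R < 2 * M" using assms False by (auto simp: R_def)
  have k12: "k \<rho>1 < k \<rho>2" using assms by (intro k_strict_mono) auto
  have dom: "0 < y \<and> y < 2 * M \<and> k \<rho>1 < k y" "0 < y \<and> y < 2 * M \<and> k \<rho>2 < k y" if "y \<in> {r..R}" for y
    using k_less[of \<rho>1 y] k_less[of \<rho>2 y] that R assms by auto
  have "integral {r..R} (f (k \<rho>1)) < integral {r..R} (f (k \<rho>2))"
    using R k12 dom by (intro integral_strict_mono continuous_on_f f_strict_mono) auto
  moreover have "F \<rho>2 R \<le> F \<rho>1 R" using assms R by (intro F_antimono) auto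
  ultimately show ?thesis using F_split[of \<rho>1 r R] F_split[of \<rho>2 r R] R assms by auto
qed

subsection \<open>Continuity and divergence at the turning point\<close>

text \<open>Monotonicity gives \<open>F \<rho>2 r \<le> F \<rho>1 r\<close>. Conversely
  \<open>f\<close> increases with \<open>c\<close>, so beyond \<open>\<rho>2\<close> the integral
  for \<open>\<rho>1\<close> is at most \<open>F \<rho>2 r\<close>, and only the piece up to
  \<open>\<rho>2\<close> remains.\<close>

lemma F_increment:
  assumes "rH < \<rho>1" "\<rho>1 \<le> \<rho>2" "\<rho>2 \<le> r" "r < 2 * M"
  shows "\<bar>F \<rho>1 r - F \<rho>2 r\<bar> \<le> F \<rho>1 \<rho>2"
proof (cases "\<rho>1 = \<rho>2")
  case False
  then have less: "\<rho>1 < \<rho>2" using assms by simp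
  have k12: "k rH < k \<rho>1" "k \<rho>1 < k \<rho>2" using less assms by (auto intro!: k_strict_mono)
  have "integral {\<rho>2..r} (f (k \<rho>1)) \<le> F \<rho>2 r"
    unfolding F_def
  proof (rule integral_mono_except_left)
    show "f (k \<rho>1) x \<le> f (k \<rho>2) x" if "x \<in> {\<rho>2<..r}" for x
      using that k12 k_less[of \<rho>2 x] assms by (intro less_imp_le[OF f_strict_mono]) auto
  qed (use assms k12 in \<open>auto intro!: f_integrable f_integrable_right\<close>)
  then show ?thesis
    using F_split[of \<rho>1 \<rho>2 r] F_strict_antimono[of \<rho>1 \<rho>2 r] less assms by auto
qed (simp add: F_self)

text \<open>The uniform constant of \<open>F_facts\<close> yields the modulus of continuity
  \<open>K * sqrt \<bar>y - x\<bar>\<close>.\<close>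

lemma continuous_on_F:
  assumes "rH < s" "r < 2 * M"
  shows "continuous_on {s..r} (\<lambda>\<rho>. F \<rho> r)"
proof -
  obtain K where K: "\<And>\<rho> x. s \<le> \<rho> \<Longrightarrow> \<rho> \<le> x \<Longrightarrow> x \<le> r \<Longrightarrow> F \<rho> x \<le> K * sqrt (x - \<rho>)"
    using F_facts[OF assms] by metis
  have bound: "\<bar>F y r - F x r\<bar> \<le> K * sqrt \<bar>y - x\<bar>" if "x \<in> {s..r}" "y \<in> {s..r}" for x y
    using F_increment[of x y r] F_increment[of y x r] K[of x y] K[of y x] that assms
    by (cases "x \<le> y") auto
  show ?thesis
    unfolding continuous_on_def
  proof
    fix x assume x: "x \<in> {s..r}"
    have "((\<lambda>y. K * sqrt \<bar>y - x\<bar>) \<longlongrightarrow> K * sqrt \<bar>x - x\<bar>) (at x within {s..r})"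
      by (intro tendsto_intros)
    then have lim: "((\<lambda>y. K * sqrt \<bar>y - x\<bar>) \<longlongrightarrow> 0) (at x within {s..r})" by simp
    have "\<forall>\<^sub>F y in at x within {s..r}. norm (F y r - F x r) \<le> K * sqrt \<bar>y - x\<bar>"
      unfolding eventually_at_filter using bound[OF x] by (intro always_eventually) simp
    from Lim_null_comparison[OF this lim]
    have "((\<lambda>y. F y r - F x r) \<longlongrightarrow> 0) (at x within {s..r})" .
    then show "((\<lambda>\<rho>. F \<rho> r) \<longlongrightarrow> F x r) (at x within {s..r})"
      by (rule LIM_zero_cancel)
  qed
qed

text \<open>Where \<open>a \<ge> 0\<close>, \<open>Q\<close> falls as \<open>c\<close> grows, so the
  quadratic bound at \<open>c = k rH\<close> holds for every slice and gives
  \<open>f \<ge> \<kappa> / (x - rH)\<close>. Integration produces an unbounded logarithm.\<close>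

lemma F_unbounded:
  assumes r: "rH < r" "r < 2 * M" and "0 \<le> B"
  obtains \<rho> where "rH < \<rho>" "\<rho> \<le> r" "B \<le> F \<rho> r"
proof -
  \<comment> \<open>The summand \<open>1\<close> makes \<open>C\<close> positive, so that division
    by \<open>sqrt C\<close> is possible.\<close>
  define C where "C = (12 * H\<^sup>2 * M\<^sup>2 + 6 * (k rH)\<^sup>2 / rH ^ 4) / rH\<^sup>2 + 1"
  have C: "0 < C" "Q (k rH) x \<le> C * (x - rH)\<^sup>2" if "rH \<le> x" "x < 2 * M" for x
  proof -
    have "0 \<le> (12 * H\<^sup>2 * M\<^sup>2 + 6 * (k rH)\<^sup>2 / rH ^ 4) / rH\<^sup>2" by simp
    then show "0 < C" unfolding C_def by linarith
    show "Q (k rH) x \<le> C * (x - rH)\<^sup>2"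
      using Q_upper[OF that] unfolding C_def distrib_right by (simp add: add_increasing2)
  qed
  have C_pos: "0 < C" using C(1) rH_less by blast
  define \<gamma> where "\<gamma> = sqrt (rH ^ 3 * (2 * M - r))"
  have \<gamma>: "0 < \<gamma>" using r rH_pos by (simp add: \<gamma>_def)
  define \<kappa> where "\<kappa> = \<gamma> / (2 * M * (2 * M) * sqrt C)"
  have \<kappa>: "0 < \<kappa>" using \<gamma> C_pos M_pos by (simp add: \<kappa>_def)
  have f_ge: "\<kappa> / (x - rH) \<le> f (k \<rho>) x" if \<rho>: "rH < \<rho>" "\<rho> < x" "x \<le> r" for \<rho> x
  proof -
    have x: "0 < x" "x < 2 * M" "k \<rho> < k x" using k_less[of \<rho> x] that r by auto
    have k\<rho>: "k rH \<le> k \<rho>" using that r by (intro k_mono) auto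
    have "\<gamma> \<le> g x" unfolding \<gamma>_def g_def using that r rH_pos
      by (intro real_sqrt_le_mono mult_mono power_mono) auto
    also have "g x \<le> a (k \<rho>) x" using x by (simp add: a_eq)
    finally have a_ge: "\<gamma> \<le> a (k \<rho>) x" .
    have Q: "0 < Q (k \<rho>) x" using x by (intro Q_pos)
    have "Q (k \<rho>) x \<le> Q (k rH) x" using x k\<rho> a_ge \<gamma> by (intro Q_mono) auto
    also have "\<dots> \<le> C * (x - rH)\<^sup>2" using that x by (intro C) auto
    finally have "sqrt (Q (k \<rho>) x) \<le> sqrt (C * (x - rH)\<^sup>2)" by (rule real_sqrt_le_mono)
    also have "\<dots> = sqrt C * (x - rH)" using that by (simp add: real_sqrt_mult)
    finally have "sqrt (Q (k \<rho>) x) \<le> sqrt C * (x - rH)" .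
    then have "\<gamma> / (2 * M * (2 * M) * (sqrt C * (x - rH))) \<le> f (k \<rho>) x"
      unfolding f_def using a_ge \<gamma> Q x M_pos C_pos that
      by (intro frac_le mult_mono mult_pos_pos mult_nonneg_nonneg) auto
    then show ?thesis by (simp add: \<kappa>_def mult_ac)
  qed
  \<comment> \<open>Chosen so that the logarithmic lower bound equals \<open>B\<close>
    exactly.\<close>
  define \<rho> where "\<rho> = rH + (r - rH) * exp (- B / \<kappa>)"
  have "\<rho> \<le> r"
  proof -
    define E where "E = exp (- B / \<kappa>)"
    have "E \<le> 1" using \<kappa> assms(3) by (simp add: E_def)
    then have "(r - rH) * E \<le> (r - rH) * 1" using r by (intro mult_left_mono) auto
    then show ?thesis unfolding \<rho>_def E_def[symmetric] by simp
  qed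
  moreover have "rH < \<rho>" using r by (simp add: \<rho>_def)
  ultimately have \<rho>: "rH < \<rho>" "\<rho> \<le> r" by auto
  have log: "((\<lambda>x. \<kappa> / (x - rH)) has_integral \<kappa> * ln (r - rH) - \<kappa> * ln (\<rho> - rH)) {\<rho>..r}"
  proof (rule fundamental_theorem_of_calculus[OF \<rho>(2)])
    fix x assume "x \<in> {\<rho>..r}"
    then have "((\<lambda>x. \<kappa> * ln (x - rH)) has_real_derivative \<kappa> / (x - rH)) (at x within {\<rho>..r})"
      using \<rho> by (auto intro!: derivative_eq_intros)
    then show "((\<lambda>x. \<kappa> * ln (x - rH)) has_vector_derivative \<kappa> / (x - rH)) (at x within {\<rho>..r})"
      by (simp add: has_real_derivative_iff_has_vector_derivative)
  qed
  have "B = \<kappa> * ln (r - rH) - \<kappa> * ln (\<rho> - rH)"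
  proof -
    have "ln (\<rho> - rH) = ln (r - rH) - B / \<kappa>" using r by (simp add: \<rho>_def ln_mult)
    then show ?thesis using \<kappa> by (simp add: right_diff_distrib)
  qed
  also have "\<dots> = integral {\<rho>..r} (\<lambda>x. \<kappa> / (x - rH))" using log by (simp add: integral_unique)
  also have "\<dots> \<le> F \<rho> r" unfolding F_def
    using log f_ge \<rho> r by (intro integral_mono_except_left f_integrable) auto
  finally show thesis using that \<rho> by blast
qed

lemma F_surj:
  assumes "rH < r" "r < 2 * M" "0 \<le> B"
  obtains \<rho> where "rH < \<rho>" "\<rho> \<le> r" "F \<rho> r = B"
proof -
  obtain s where s: "rH < s" "s \<le> r" "B \<le> F s r" using F_unbounded[OF assms] .
  obtain \<rho> where "s \<le> \<rho>" "\<rho> \<le> r" "F \<rho> r = B"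
    using IVT2'[of "\<lambda>\<rho>. F \<rho> r" r B s] s assms continuous_on_F[OF s(1) assms(2)] F_self[of r]
    by auto
  then show thesis using that[of \<rho>] s by auto
qed

subsection \<open>Slices in Kruskal coordinates\<close>

text \<open>The integrand of \<open>V_plus\<close> splits as \<open>f + x / (x - 2 * M)\<close>. The
  second part has the primitive \<open>x + 2 * M * ln (2 * M - x)\<close>, whose value at
  \<open>\<rho>\<close> cancels the explicit throat terms.\<close>

lemma V_plus_eq:
  assumes "rH < \<rho>" "\<rho> \<le> r" "r < 2 * M"
  shows "V_plus M H (k \<rho>) r = sqrt (2 * M - r) * exp (r / (4 * M)) * exp (F \<rho> r / (4 * M))"
proof -
  let ?v = "\<lambda>x. x ^ 4 / (D_fun M H (k \<rho>) x - A_fun H (k \<rho>) x * sqrt (D_fun M H (k \<rho>) x))"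
  have v_eq: "?v x = f (k \<rho>) x + x / (x - 2 * M)" if "x \<in> {\<rho><..r}" for x
  proof -
    have x: "0 < x" "x < 2 * M" "k \<rho> < k x" using k_less[of \<rho> x] that assms by auto
    define s A where "s = sqrt (Q (k \<rho>) x)" and "A = a (k \<rho>) x"
    have s: "0 < s" "s\<^sup>2 = Q (k \<rho>) x" using Q_pos[OF x] by (auto simp: s_def)
    have A: "0 < A" using x g_pos[of x] by (simp add: A_def a_eq)
    have rel: "A\<^sup>2 - x ^ 4 * s\<^sup>2 = x ^ 3 * (2 * M - x)"
      unfolding s(2) A_def using x by (simp add: Q_factor g_sq)
    have "sqrt (x ^ 4) = x\<^sup>2" by (rule real_sqrt_unique) auto
    then have "?v x = x ^ 4 / (x ^ 4 * s\<^sup>2 + A * (x\<^sup>2 * s))"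
      using x(1) s by (simp add: D_fun_eq real_sqrt_mult A_def a_def A_fun_def s_def) (simp add: algebra_simps)
    also have "\<dots> = x\<^sup>2 / (s * (x\<^sup>2 * s + A))"
    proof -
      have "x ^ 4 * s\<^sup>2 + A * (x\<^sup>2 * s) = x\<^sup>2 * (s * (x\<^sup>2 * s + A))" by algebra
      then show ?thesis using x(1) by (simp add: power4_eq_xxxx power2_eq_square)
    qed
    \<comment> \<open>Expansion by the conjugate \<open>A - x\<^sup>2 * s\<close>, using
      \<open>rel\<close>; the local \<open>A\<close> is the negative of
      \<open>A_fun\<close>.\<close>
    also have "\<dots> = (A - x\<^sup>2 * s) / (x * (2 * M - x) * s)"
    proof -
      have "0 < x\<^sup>2 * s + A" using x s A by (intro add_nonneg_pos) auto
      moreover have "(A - x\<^sup>2 * s) * (x\<^sup>2 * s + A) = x\<^sup>2 * (x * (2 * M - x))"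
        using rel by algebra
      ultimately show ?thesis using x s by (simp add: frac_eq_eq)
    qed
    also have "\<dots> = f (k \<rho>) x + x / (x - 2 * M)"
      using x s(1) unfolding f_def A_def[symmetric] s_def[symmetric]
      by (simp add: divide_simps) algebra
    finally show ?thesis .
  qed
  have elem: "((\<lambda>x. x / (x - 2 * M)) has_integral
      (r + 2 * M * ln (2 * M - r)) - (\<rho> + 2 * M * ln (2 * M - \<rho>))) {\<rho>..r}"
  proof (rule fundamental_theorem_of_calculus[OF assms(2)])
    fix x assume "x \<in> {\<rho>..r}"
    then have "((\<lambda>x. x + 2 * M * ln (2 * M - x)) has_real_derivative x / (x - 2 * M)) (at x within {\<rho>..r})"
      using assms by (auto intro!: derivative_eq_intros simp: divide_simps) (simp add: algebra_simps)
    then show "((\<lambda>x. x + 2 * M * ln (2 * M - x)) has_vector_derivative x / (x - 2 * M)) (at x within {\<rho>..r})"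
      by (simp add: has_real_derivative_iff_has_vector_derivative)
  qed
  \<comment> \<open>\<open>v_eq\<close> leaves out the throat itself, a null set.\<close>
  have "integral {\<rho>..r} ?v = integral {\<rho>..r} (\<lambda>x. f (k \<rho>) x + x / (x - 2 * M))"
    by (rule integral_spike[of "{\<rho>}"]) (use v_eq in auto)
  also have "\<dots> = F \<rho> r + integral {\<rho>..r} (\<lambda>x. x / (x - 2 * M))"
    unfolding F_def using f_integrable[OF assms] elem by (intro integral_add) auto
  also have "integral {\<rho>..r} (\<lambda>x. x / (x - 2 * M)) =
      (r + 2 * M * ln (2 * M - r)) - (\<rho> + 2 * M * ln (2 * M - \<rho>))"
    using elem by (rule integral_unique)
  finally have int: "integral {\<rho>..r} ?v = F \<rho> r + (r + 2 * M * ln (2 * M - r)) - (\<rho> + 2 * M * ln (2 * M - \<rho>))"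
    by simp
  have "r_plus M H (k \<rho>) = \<rho>" using assms by (intro r_plus_k) auto
  moreover have "\<bar>\<rho> - 2 * M\<bar> = 2 * M - \<rho>" using assms by simp
  ultimately have "V_plus M H (k \<rho>) r = exp (1 / (4 * M) * (F \<rho> r + r + 2 * M * ln (2 * M - r)))"
    unfolding V_plus_def by (simp only: int) simp
  also have "1 / (4 * M) * (F \<rho> r + r + 2 * M * ln (2 * M - r)) =
      ln (2 * M - r) / 2 + r / (4 * M) + F \<rho> r / (4 * M)"
    using M_pos by (simp add: field_simps)
  also have "exp \<dots> = sqrt (2 * M - r) * exp (r / (4 * M)) * exp (F \<rho> r / (4 * M))"
    using assms by (simp add: exp_add ln_sqrt[symmetric])
  finally show ?thesis .
qed

text \<open>\<open>\<tau>\<close> is \<open>2 * M * ln (V / - U)\<close>, the Schwarzschild time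
  inside the horizon; the reflection negates it.\<close>

definition chart :: "real \<Rightarrow> real \<Rightarrow> real \<times> real" where
  "chart r \<tau> = (- (sqrt (2 * M - r) * exp (r / (4 * M)) * exp (- \<tau> / (4 * M))),
     sqrt (2 * M - r) * exp (r / (4 * M)) * exp (\<tau> / (4 * M)))"

lemma radius_function_strict_mono:
  assumes "0 \<le> x" "x < y"
  shows "(x - 2 * M) * exp (x / (2 * M)) < (y - 2 * M) * exp (y / (2 * M))"
proof (rule DERIV_pos_imp_increasing_open[OF assms(2)], intro exI conjI)
  fix z assume z: "x < z" "z < y"
  show "((\<lambda>r. (r - 2 * M) * exp (r / (2 * M))) has_real_derivative
      exp (z / (2 * M)) + (z - 2 * M) * (exp (z / (2 * M)) / (2 * M))) (at z)"
    using M_pos by (auto intro!: derivative_eq_intros)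
  have "exp (z / (2 * M)) + (z - 2 * M) * (exp (z / (2 * M)) / (2 * M)) = exp (z / (2 * M)) * (z / (2 * M))"
    using M_pos by (simp add: field_simps)
  then show "0 < exp (z / (2 * M)) + (z - 2 * M) * (exp (z / (2 * M)) / (2 * M))"
    using z assms M_pos by simp
qed (use M_pos in \<open>auto intro!: continuous_intros\<close>)

lemma area_radius_eq:
  assumes "0 < r" "(r - 2 * M) * exp (r / (2 * M)) = U * V"
  shows "area_radius M (U, V) = r"
  unfolding area_radius_def
proof (rule the_equality)
  show "x = r" if "0 < x \<and> (x - 2 * M) * exp (x / (2 * M)) = fst (U, V) * snd (U, V)" for x
    using that assms radius_function_strict_mono[of x r] radius_function_strict_mono[of r x]
    by (cases x r rule: linorder_cases) auto
qed (use assms in auto)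

lemma chart_product:
  assumes "r \<le> 2 * M"
  shows "fst (chart r \<tau>) * snd (chart r \<tau>) = (r - 2 * M) * exp (r / (2 * M))"
proof -
  have "fst (chart r \<tau>) * snd (chart r \<tau>) = - (sqrt (2 * M - r) * sqrt (2 * M - r)) *
      (exp (r / (4 * M)) * exp (r / (4 * M))) * (exp (- \<tau> / (4 * M)) * exp (\<tau> / (4 * M)))"
  proof -
    have "- (s * x * y) * (s * x * z) = - (s * s) * (x * x) * (y * z)" for s x y z :: real
      by algebra
    then show ?thesis by (simp only: chart_def fst_conv snd_conv)
  qed
  moreover have "exp (r / (4 * M)) * exp (r / (4 * M)) = exp (r / (2 * M))"
    using M_pos by (simp add: exp_add[symmetric] field_simps)
  moreover have "exp (- \<tau> / (4 * M)) * exp (\<tau> / (4 * M)) = 1"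
    by (simp add: exp_add[symmetric])
  moreover have "sqrt (2 * M - r) * sqrt (2 * M - r) = 2 * M - r" using assms by simp
  ultimately show ?thesis by (simp only: mult_1_right minus_diff_eq)
qed

lemma area_radius_chart:
  assumes "0 < r" "r \<le> 2 * M"
  shows "area_radius M (chart r \<tau>) = r"
  using area_radius_eq[of r "fst (chart r \<tau>)" "snd (chart r \<tau>)"] chart_product[of r] assms by simp

lemma chart_in_region_II:
  assumes "0 < r" "r < 2 * M"
  shows "chart r \<tau> \<in> region_II M"
proof -
  have "- 2 * M < fst (chart r \<tau>) * snd (chart r \<tau>)"
    using radius_function_strict_mono[of 0 r] assms chart_product[of r] by simp
  then show ?thesis
    using assms by (simp add: region_II_def kruskal_plane_def chart_def)
qed

lemma chart_inj:
  assumes "chart r \<tau> = chart r \<tau>'" "r < 2 * M"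
  shows "\<tau> = \<tau>'"
  using assms M_pos by (simp add: chart_def)

lemma region_II_chart:
  assumes "p \<in> region_II M"
  obtains r \<tau> where "0 < r" "r < 2 * M" "p = chart r \<tau>"
proof -
  obtain U V where p: "p = (U, V)" and UV: "- 2 * M < U * V" "U < 0" "0 < V"
    using assms by (auto simp: region_II_def kruskal_plane_def)
  let ?\<rho> = "\<lambda>r. (r - 2 * M) * exp (r / (2 * M))"
  have neg: "U * V < 0" using UV by (simp add: mult_neg_pos)
  obtain r where r: "0 \<le> r" "r \<le> 2 * M" "?\<rho> r = U * V"
  proof -
    have "continuous_on {0..2 * M} ?\<rho>" using M_pos by (intro continuous_intros) auto
    then show thesis using IVT'[of ?\<rho> 0 "U * V" "2 * M"] UV neg M_pos that by auto
  qed
  have "r \<noteq> 0" using r(3) UV(1) by (intro notI) simp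
  moreover have "r \<noteq> 2 * M" using r(3) neg by (intro notI) auto
  ultimately have r': "0 < r" "r < 2 * M" using r(1,2) by simp_all
  define W where "W = sqrt (2 * M - r) * exp (r / (4 * M))"
  have W: "0 < W" using r' by (simp add: W_def)
  \<comment> \<open>Only \<open>V\<close> is matched here; \<open>U\<close> then follows from the
    product \<open>U * V\<close>.\<close>
  define \<tau> where "\<tau> = 4 * M * ln (V / W)"
  have exp\<tau>: "exp (\<tau> / (4 * M)) = V / W" using M_pos UV W by (simp add: \<tau>_def)
  then have "snd (chart r \<tau>) = V" using W by (auto simp: chart_def W_def)
  moreover from this have "fst (chart r \<tau>) * V = U * V" using chart_product[of r \<tau>] r by simp
  then have "fst (chart r \<tau>) = U" using UV by simp
  ultimately show thesis using that[OF r'] p by (metis prod.collapse)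
qed

lemma T_reflection_chart: "T_reflection (chart r \<tau>) = chart r (- \<tau>)"
  by (simp add: T_reflection_def chart_def)

section \<open>The slices inside region II\<close>

lemma V_plus_pos: "0 < V_plus M H c r"
  by (simp add: V_plus_def)

lemma U_V_plus_chart:
  assumes "rH < \<rho>" "\<rho> \<le> r" "r < 2 * M"
  shows "(U_plus M H (k \<rho>) r, V_plus M H (k \<rho>) r) = chart r (F \<rho> r)"
proof -
  have V: "V_plus M H (k \<rho>) r = snd (chart r (F \<rho> r))"
    using V_plus_eq[OF assms] by (simp add: chart_def)
  then have "0 < snd (chart r (F \<rho> r))" by (metis V_plus_pos)
  then have "U_plus M H (k \<rho>) r = fst (chart r (F \<rho> r))"
    unfolding U_plus_def V using chart_product[of r "F \<rho> r"] assms by (simp add: field_simps)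
  with V show ?thesis by (metis prod.collapse)
qed

lemma Sigma_plus_region_II:
  assumes "rH < \<rho>" "\<rho> < 2 * M"
  shows "Sigma_plus M H (k \<rho>) \<inter> region_II M = {chart r \<tau> | r \<tau>. \<rho> \<le> r \<and> r < 2 * M \<and> \<bar>\<tau>\<bar> = F \<rho> r}"
    (is "?L = ?R")
proof -
  let ?curve = "\<lambda>r. (U_plus M H (k \<rho>) r, V_plus M H (k \<rho>) r)"
  have "k \<rho> \<noteq> - 8 * M ^ 3 * H" using k_strict_mono[of \<rho> "2 * M"] k_horizon assms by auto
  then have Sigma: "Sigma_plus M H (k \<rho>) = ?curve ` {\<rho>..} \<union> T_reflection ` ?curve ` {\<rho>..}"
    by (simp add: Sigma_plus_def T_symmetrize_def r_plus_k assms)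
  \<comment> \<open>From the horizon on, \<open>U \<ge> 0\<close>, and the reflected point has
    second coordinate \<open>- U \<le> 0\<close>.\<close>
  have outside: "?curve r \<notin> region_II M" "T_reflection (?curve r) \<notin> region_II M" if "2 * M \<le> r" for r
  proof -
    have "0 \<le> U_plus M H (k \<rho>) r"
      using that V_plus_pos[of "k \<rho>" r] by (simp add: U_plus_def)
    then show "?curve r \<notin> region_II M" "T_reflection (?curve r) \<notin> region_II M"
      by (auto simp: region_II_def T_reflection_def)
  qed
  show ?thesis
  proof
    show "?L \<subseteq> ?R"
    proof
      fix p assume p: "p \<in> ?L"
      then obtain r where r: "\<rho> \<le> r" "p = ?curve r \<or> p = T_reflection (?curve r)"
        unfolding Sigma by auto
      then have "r < 2 * M" using outside p by (metis IntD2 not_less)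
      then have "p = chart r (F \<rho> r) \<or> p = chart r (- F \<rho> r)"
        using r U_V_plus_chart[OF assms(1) r(1)] T_reflection_chart by auto
      moreover have "0 \<le> F \<rho> r"
        by (rule F_facts[of \<rho> r]) (use assms r \<open>r < 2 * M\<close> in auto)
      ultimately show "p \<in> ?R" using r \<open>r < 2 * M\<close> by fastforce
    qed
    show "?R \<subseteq> ?L"
    proof
      fix p assume "p \<in> ?R"
      then obtain r \<tau> where p: "p = chart r \<tau>" "\<rho> \<le> r" "r < 2 * M" "\<bar>\<tau>\<bar> = F \<rho> r" by auto
      have "p = ?curve r \<or> p = T_reflection (?curve r)"
        unfolding U_V_plus_chart[OF assms(1) p(2,3)] T_reflection_chart
        using p(1,4) by (metis abs_if minus_minus)
      then have "p \<in> Sigma_plus M H (k \<rho>)" unfolding Sigma using p(2) by auto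
      moreover have "p \<in> region_II M"
        unfolding p(1) using p(2,3) assms rH_pos by (intro chart_in_region_II) auto
      ultimately show "p \<in> ?L" by simp
    qed
  qed
qed

lemma Sigma_critical_region_II: "Sigma_critical M H \<inter> region_II M = {}"
proof -
  have "0 \<le> U_critical M H r" "0 \<le> V_critical M H r" if "2 * M \<le> r" for r
    using that by (simp_all add: U_critical_def V_critical_def)
  then show ?thesis
    by (fastforce simp: Sigma_critical_def T_symmetrize_def T_reflection_def region_II_def)
qed

lemma slice_parameter:
  assumes "c \<in> {c_min M H<..- 8 * M ^ 3 * H}"
  obtains "Sigma_plus M H c \<inter> region_II M = {}"
  | \<rho> where "rH < \<rho>" "\<rho> < 2 * M" "c = k \<rho>"
proof (cases "c = - 8 * M ^ 3 * H")
  case True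
  then show thesis using that(1) Sigma_critical_region_II by (simp add: Sigma_plus_def)
next
  case False
  then have "k rH < c" "c < k (2 * M)" using assms by (auto simp: c_min_eq k_horizon)
  then obtain \<rho> where "rH < \<rho>" "\<rho> < 2 * M" "k \<rho> = c"
    using k_inverse[of c "2 * M"] rH_less by auto
  then show thesis using that(2) by auto
qed

text \<open>A common point has the same \<open>r\<close> and \<open>\<tau>\<close> on both slices,
  and \<open>\<bar>\<tau>\<bar>\<close> fixes the throat by strict monotonicity, whichever half
  contains the point.\<close>

lemma disjoint_slices:
  "disjoint_family_on (\<lambda>c. Sigma_plus M H c \<inter> region_II M) {c_min M H<..- 8 * M ^ 3 * H}"
  unfolding disjoint_family_on_def
proof (intro ballI impI equals0I)
  fix c d p
  assume c: "c \<in> {c_min M H<..- 8 * M ^ 3 * H}" and d: "d \<in> {c_min M H<..- 8 * M ^ 3 * H}"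
    and "c \<noteq> d" and "p \<in> (Sigma_plus M H c \<inter> region_II M) \<inter> (Sigma_plus M H d \<inter> region_II M)"
  then have pc: "p \<in> Sigma_plus M H c \<inter> region_II M" and pd: "p \<in> Sigma_plus M H d \<inter> region_II M" by auto
  obtain \<rho> where \<rho>: "rH < \<rho>" "\<rho> < 2 * M" "c = k \<rho>" using slice_parameter[OF c] pc by blast
  obtain \<sigma> where \<sigma>: "rH < \<sigma>" "\<sigma> < 2 * M" "d = k \<sigma>" using slice_parameter[OF d] pd by blast
  obtain r \<tau> where r: "p = chart r \<tau>" "\<rho> \<le> r" "r < 2 * M" "\<bar>\<tau>\<bar> = F \<rho> r"
    using pc Sigma_plus_region_II[OF \<rho>(1,2)] \<rho>(3) by auto
  obtain r' \<tau>' where r': "p = chart r' \<tau>'" "\<sigma> \<le> r'" "r' < 2 * M" "\<bar>\<tau>'\<bar> = F \<sigma> r'"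
    using pd Sigma_plus_region_II[OF \<sigma>(1,2)] \<sigma>(3) by auto
  have "r = r'" using area_radius_chart[of r \<tau>] area_radius_chart[of r' \<tau>'] r r' \<rho> \<sigma> rH_pos by auto
  moreover from this have "\<tau> = \<tau>'" using chart_inj[of r \<tau> \<tau>'] r r' by simp
  ultimately have "F \<rho> r = F \<sigma> r" using r r' by simp
  then have "\<rho> = \<sigma>"
    using F_strict_antimono[of \<rho> \<sigma> r] F_strict_antimono[of \<sigma> \<rho> r] \<rho> \<sigma> r r' \<open>r = r'\<close>
    by (cases \<rho> \<sigma> rule: linorder_cases) auto
  then show False using \<open>c \<noteq> d\<close> \<rho> \<sigma> by simp
qed

lemma union_slices:
  "(\<Union>c\<in>{c_min M H<..- 8 * M ^ 3 * H}. Sigma_plus M H c \<inter> region_II M) =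
    {p \<in> region_II M. rH < area_radius M p \<and> area_radius M p < 2 * M}" (is "?L = ?R")
proof
  show "?L \<subseteq> ?R"
  proof
    fix p assume "p \<in> ?L"
    then obtain c where c: "c \<in> {c_min M H<..- 8 * M ^ 3 * H}" and p: "p \<in> Sigma_plus M H c \<inter> region_II M"
      by auto
    obtain \<rho> where \<rho>: "rH < \<rho>" "\<rho> < 2 * M" "c = k \<rho>" using slice_parameter[OF c] p by blast
    obtain r \<tau> where r: "p = chart r \<tau>" "\<rho> \<le> r" "r < 2 * M"
      using p Sigma_plus_region_II[OF \<rho>(1,2)] \<rho>(3) by auto
    then show "p \<in> ?R" using area_radius_chart[of r \<tau>] p \<rho> rH_pos by auto
  qed
  show "?R \<subseteq> ?L"
  proof
    fix p assume p: "p \<in> ?R"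
    then obtain r \<tau> where r: "0 < r" "r < 2 * M" "p = chart r \<tau>" using region_II_chart by blast
    then have "rH < r" using p area_radius_chart[of r \<tau>] by auto
    \<comment> \<open>\<open>F\<close> is nonnegative; the sign of \<open>\<tau>\<close> decides
      between the curve and its reflection.\<close>
    then obtain \<rho> where \<rho>: "rH < \<rho>" "\<rho> \<le> r" "F \<rho> r = \<bar>\<tau>\<bar>" using F_surj[of r "\<bar>\<tau>\<bar>"] r by auto
    have "k \<rho> \<in> {c_min M H<..- 8 * M ^ 3 * H}"
      using k_strict_mono[of rH \<rho>] k_strict_mono[of \<rho> "2 * M"] \<rho> r k_horizon by (auto simp: c_min_eq)
    moreover have "p \<in> Sigma_plus M H (k \<rho>) \<inter> region_II M"
      using Sigma_plus_region_II[of \<rho>] \<rho> r by fastforce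
    ultimately show "p \<in> ?L" by blast
  qed
qed

end

subsection \<open>Exchanging \<open>U\<close> and \<open>V\<close>\<close>

lemma swap_image_Int: "prod.swap ` (A \<inter> B) = prod.swap ` A \<inter> prod.swap ` B"
  by auto

lemma area_radius_swap: "area_radius M (prod.swap p) = area_radius M p"
  by (simp add: area_radius_def mult.commute)

lemma region_II'_swap: "region_II' M = prod.swap ` region_II M"
  by (force simp: region_II'_def region_II_def kruskal_plane_def mult.commute)

lemma T_symmetrize_swap: "T_symmetrize (prod.swap ` S) = prod.swap ` T_symmetrize S"
  by (simp add: T_symmetrize_def T_reflection_def image_Un image_image prod.swap_def)

lemma k_tilde_eq: "k_tilde M H r = - k_fun M (- H) r"
  by (simp add: k_tilde_def k_fun_def)

lemma R_max_eq: "R_max M H = r_min M (- H)"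
  by (simp add: R_max_def r_min_def is_arg_max_def is_arg_min_def k_tilde_eq)

lemma C_max_eq: "C_max M H = - c_min M (- H)"
  by (simp add: C_max_def c_min_def R_max_eq k_tilde_eq)

lemma r_tilde_minus_eq: "r_tilde_minus M H c = r_plus M (- H) (- c)"
proof -
  have "(k_tilde M H r = c) = (k_fun M (- H) r = - c)" for r
    by (auto simp: k_tilde_eq)
  then show ?thesis by (simp add: r_tilde_minus_def r_plus_def R_max_eq)
qed

lemma A_fun_minus: "A_fun (- H) (- c) x = - A_fun H c x"
  by (simp add: A_fun_def)

lemma D_fun_minus: "D_fun M (- H) (- c) x = D_fun M H c x"
  by (simp add: D_fun_def power2_eq_square algebra_simps)

text \<open>Negating \<open>H\<close> and \<open>c\<close> flips \<open>A\<close> and keeps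
  \<open>D\<close>, which turns \<open>D + A * sqrt D\<close> into
  \<open>D - A * sqrt D\<close>.\<close>

lemma U_tilde_minus_eq: "U_tilde_minus M H c r = V_plus M (- H) (- c) r"
  by (simp add: U_tilde_minus_def V_plus_def r_tilde_minus_eq A_fun_minus D_fun_minus)

lemma V_tilde_minus_eq: "V_tilde_minus M H c r = U_plus M (- H) (- c) r"
  by (simp add: V_tilde_minus_def U_plus_def U_tilde_minus_eq)

lemma critical_integral_minus: "critical_integral M (- H) r = - critical_integral M H r"
proof -
  let ?c = "- 8 * M ^ 3 * H"
  have "- 8 * M ^ 3 * - H = - ?c" by simp
  then show ?thesis
    unfolding critical_integral_def Let_def
    by (simp only: A_fun_minus D_fun_minus) (simp only: minus_divide_left[symmetric] integral_neg)
qed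

text \<open>The critical integral is odd in \<open>H\<close>, so negating \<open>H\<close> exchanges
  the two exponents.\<close>

lemma Sigma_critical_swap: "Sigma_critical M H = prod.swap ` Sigma_critical M (- H)"
proof -
  have "U_critical M (- H) = V_critical M H" "V_critical M (- H) = U_critical M H"
    by (auto simp: U_critical_def V_critical_def critical_integral_minus)
  then show ?thesis
    by (simp add: Sigma_critical_def T_symmetrize_swap[symmetric] image_image)
qed

lemma Sigma_tilde_minus_swap: "Sigma_tilde_minus M H c = prod.swap ` Sigma_plus M (- H) (- c)"
proof (cases "c = - 8 * M ^ 3 * H")
  case True
  then show ?thesis using Sigma_critical_swap[of M H] by (simp add: Sigma_tilde_minus_def Sigma_plus_def)
next
  case False
  then have "- c \<noteq> - 8 * M ^ 3 * - H" by simp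
  with False show ?thesis
    by (simp add: Sigma_tilde_minus_def Sigma_plus_def T_symmetrize_swap[symmetric] image_image
        U_tilde_minus_eq V_tilde_minus_eq r_tilde_minus_eq)
qed

theorem theorem3p16:
  fixes M :: real
  assumes "M > 0"
  shows "\<exists>C::real. C > 0 \<and>
    (\<forall>H::real. H \<ge> - C \<longrightarrow>
       disjoint_family_on (\<lambda>c. Sigma_plus M H c \<inter> region_II M) {c_min M H<..- 8 * M ^ 3 * H} \<and>
       (\<Union>c\<in>{c_min M H<..- 8 * M ^ 3 * H}. Sigma_plus M H c \<inter> region_II M) =
         {p \<in> region_II M. r_min M H < area_radius M p \<and> area_radius M p < 2 * M}) \<and>
    (\<forall>H::real. H \<le> C \<longrightarrow>
       disjoint_family_on (\<lambda>c. Sigma_tilde_minus M H c \<inter> region_II' M) {- 8 * M ^ 3 * H<..<C_max M H} \<and>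
       (\<Union>c\<in>{- 8 * M ^ 3 * H<..<C_max M H}. Sigma_tilde_minus M H c \<inter> region_II' M) =
         {p \<in> region_II' M. R_max M H < area_radius M p \<and> area_radius M p < 2 * M})"
proof (intro exI[of _ 1] conjI allI impI)
  \<comment> \<open>The slice lemmas are stated for every real \<open>H\<close>, so the witness
    \<open>1\<close> is an arbitrary positive number.\<close>
  have kr: "kruskal M" using assms by (simp add: kruskal_def)
  fix H :: real
  show "disjoint_family_on (\<lambda>c. Sigma_plus M H c \<inter> region_II M) {c_min M H<..- 8 * M ^ 3 * H}"
    by (rule kruskal.disjoint_slices[OF kr])
  show "(\<Union>c\<in>{c_min M H<..- 8 * M ^ 3 * H}. Sigma_plus M H c \<inter> region_II M) =
         {p \<in> region_II M. r_min M H < area_radius M p \<and> area_radius M p < 2 * M}"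
    by (rule kruskal.union_slices[OF kr])
  let ?I = "{c_min M (- H)<..- 8 * M ^ 3 * - H}"
  let ?J = "{- 8 * M ^ 3 * H<..<C_max M H}"
  have slice: "Sigma_tilde_minus M H c \<inter> region_II' M = prod.swap ` (Sigma_plus M (- H) (- c) \<inter> region_II M)" for c
    by (simp only: Sigma_tilde_minus_swap region_II'_swap swap_image_Int)
  show "disjoint_family_on (\<lambda>c. Sigma_tilde_minus M H c \<inter> region_II' M) ?J"
    unfolding disjoint_family_on_def slice swap_image_Int[symmetric]
  proof (intro ballI impI)
    fix c d assume "c \<in> ?J" "d \<in> ?J" "c \<noteq> d"
    then have "- c \<in> ?I" "- d \<in> ?I" "- c \<noteq> - d" by (auto simp: C_max_eq)
    then show "prod.swap ` ((Sigma_plus M (- H) (- c) \<inter> region_II M) \<inter>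
        (Sigma_plus M (- H) (- d) \<inter> region_II M)) = {}"
      using kruskal.disjoint_slices[OF kr, of "- H"] unfolding disjoint_family_on_def by blast
  qed
  have "(\<Union>c\<in>?J. Sigma_tilde_minus M H c \<inter> region_II' M) =
      prod.swap ` (\<Union>c\<in>?I. Sigma_plus M (- H) c \<inter> region_II M)"
  proof -
    \<comment> \<open>\<open>?I\<close> contains the critical value while the negatives of
      \<open>?J\<close> do not; the critical slice misses region II, so the unions still
      agree.\<close>
    have crit: "Sigma_plus M (- H) (- 8 * M ^ 3 * - H) \<inter> region_II M = {}"
      using kruskal.Sigma_critical_region_II[OF kr, of "- H"] by (simp add: Sigma_plus_def)
    have "(\<Union>c\<in>?I. Sigma_plus M (- H) c \<inter> region_II M) = (\<Union>c\<in>?J. Sigma_plus M (- H) (- c) \<inter> region_II M)"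
    proof (intro equalityI UN_least)
      fix c assume c: "c \<in> ?I"
      show "Sigma_plus M (- H) c \<inter> region_II M \<subseteq> (\<Union>c\<in>?J. Sigma_plus M (- H) (- c) \<inter> region_II M)"
      proof (cases "c = - 8 * M ^ 3 * - H")
        case False
        with c have "- c \<in> ?J" by (auto simp: C_max_eq)
        then show ?thesis by (rule UN_upper[THEN order_trans[rotated]]) simp
      qed (use crit in simp)
    next
      fix c assume "c \<in> ?J"
      then have "- c \<in> ?I" by (auto simp: C_max_eq)
      then show "Sigma_plus M (- H) (- c) \<inter> region_II M \<subseteq> (\<Union>c\<in>?I. Sigma_plus M (- H) c \<inter> region_II M)"
        by (rule UN_upper)
    qed
    then show ?thesis by (simp only: slice image_UN)
  qed
  also have "\<dots> = {p \<in> region_II' M. R_max M H < area_radius M p \<and> area_radius M p < 2 * M}"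
    unfolding kruskal.union_slices[OF kr] region_II'_swap R_max_eq
    using area_radius_swap by (auto 0 3 simp del: swap_simp)
  finally show "(\<Union>c\<in>?J. Sigma_tilde_minus M H c \<inter> region_II' M) =
      {p \<in> region_II' M. R_max M H < area_radius M p \<and> area_radius M p < 2 * M}" .
qed simp

end
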